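(* Let $V\in \mathcal{C}^3(\mathbb{R}^d;\mathbb{R})$ and let $H(x)=\nabla^2 V(x)$. For each $x\in\mathbb{R}^d$ let $v(x)$ be a normalized eigenvector corresponding to the smallest eigenvalue of $H(x)$, i.e. $v(x)\in\operatorname{argmin}_{u\in\mathbb{R}^d,\ \|u\|=1} u^{T}H(x)u$. Let $\alpha,\beta\in\mathbb{R}$ satisfy $\alpha+\beta>1$, and define, as a function of $y\in\mathbb{R}^d$ with parameter $x\in\mathbb{R}^d$, $$L(y;x,\alpha,\beta)=(1-\alpha)V(y)+\alpha V\big(y-v(x)v(x)^{T}(y-x)\big)-\beta V\big(x+v(x)v(x)^{T}(y-x)\big).$$ Suppose that $x^*$ is an index-1 saddle point of $V$. Then: (i) $x^*$ is a local minimizer of $y\mapsto L(y;x^*,\alpha,\beta)$. Moreover, there exists a neighborhood $\mathcal{U}$ of $x^*$ for which the following hold. (ii) For every $x\in\mathcal{U}$, the function $y\mapsto L(y;x,\alpha,\beta)$ is strictly convex in $y\in\mathcal{U}$ and has a unique minimum in $\mathcal{U}$. (iii) Define $\Phi:\mathcal{U}\to\mathcal{U}$ by letting $\Phi(x)$ be the unique local minimizer of $y\mapsto L(y;x,\alpha,\beta)$ in $\mathcal{U}$. If, further, $\mathcal{U}$ contains no stationary point of $V$ other than $x^*$, then $\Phi$ has exactly one fixed point, namely $x^*$. (iv) $\Phi$ is differentiable in $\mathcal{U}$, and its Jacobian matrix vanishes at $x^*$: $\Phi_x(x^* )=0$.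
   Context: A point $x^*$ is an index-1 saddle point of $V$ if $\nabla V(x^* )=0$ and the Hessian $\nabla^2V(x^* )$ has exactly one negative eigenvalue (simple), all its other eigenvalues being strictly positive. The vector $v(x)$ is determined only up to sign when the smallest eigenvalue is simple, but $L$ depends on $v(x)$ only through the matrix $v(x)v(x)^{T}$. Neighborhoods are understood to be open, and convex so that strict convexity on $\mathcal{U}$ makes sense. *)

theory Defs
  imports "HOL-Analysis.Analysis"
begin

definition partial_deriv :: "'n::finite \<Rightarrow> (real^'n \<Rightarrow> real) \<Rightarrow> real^'n \<Rightarrow> real" where
  "partial_deriv i f x = frechet_derivative f (at x) (axis i 1)"

(* C^k on all of R^n. Total differentiability is demanded at each stage, so that
   partial_deriv (whose value is unspecified at points where f is not differentiable)
   is meaningful; for k >= 1 this is the usual "all partial derivatives up to order k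
   exist and are continuous". *)
primrec continuously_differentiable :: "nat \<Rightarrow> (real^'n::finite \<Rightarrow> real) \<Rightarrow> bool" where
  "continuously_differentiable 0 f \<longleftrightarrow> continuous_on UNIV f"
| "continuously_differentiable (Suc k) f \<longleftrightarrow>
     f differentiable_on UNIV \<and> (\<forall>i. continuously_differentiable k (partial_deriv i f))"

definition gradient :: "(real^'n::finite \<Rightarrow> real) \<Rightarrow> real^'n \<Rightarrow> real^'n" where
  "gradient f x = (\<chi> i. partial_deriv i f x)"

definition hessian :: "(real^'n::finite \<Rightarrow> real) \<Rightarrow> real^'n \<Rightarrow> real^'n^'n" where
  "hessian f x = jacobian (gradient f) (at x)"

definition eigenspace :: "real^'n^'n::finite \<Rightarrow> real \<Rightarrow> (real^'n) set" where
  "eigenspace A l = {u. A *v u = l *\<^sub>R u}"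

definition eigenvalue :: "real^'n^'n::finite \<Rightarrow> real \<Rightarrow> bool" where
  "eigenvalue A l \<longleftrightarrow> (\<exists>u. u \<noteq> 0 \<and> u \<in> eigenspace A l)"

(* Multiplicity is the dimension of the eigenspace; the Hessian of a C^2 function is
   symmetric, so algebraic and geometric multiplicities coincide. *)
definition index1_saddle :: "(real^'n::finite \<Rightarrow> real) \<Rightarrow> real^'n \<Rightarrow> bool" where
  "index1_saddle V x \<longleftrightarrow> gradient V x = 0 \<and>
     (\<exists>l<0. eigenvalue (hessian V x) l \<and> dim (eigenspace (hessian V x) l) = 1 \<and>
        (\<forall>m. eigenvalue (hessian V x) m \<and> m \<noteq> l \<longrightarrow> m > 0))"

(* the matrix w w^T *)
definition outer_square :: "real^'n::finite \<Rightarrow> real^'n^'n" where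
  "outer_square w = (\<chi> i j. w $ i * w $ j)"

(* imf_objective V w \<alpha> \<beta> x y is L(y; x, \<alpha>, \<beta>) with w in place of v(x); x precedes y so that
   imf_objective V w \<alpha> \<beta> x is the function of y to be minimized. *)
definition imf_objective ::
  "(real^'n::finite \<Rightarrow> real) \<Rightarrow> real^'n \<Rightarrow> real \<Rightarrow> real \<Rightarrow> real^'n \<Rightarrow> real^'n \<Rightarrow> real" where
  "imf_objective V w \<alpha> \<beta> x y =
     (1 - \<alpha>) * V y + \<alpha> * V (y - outer_square w *v (y - x))
       - \<beta> * V (x + outer_square w *v (y - x))"

definition local_minimizer :: "('a::topological_space \<Rightarrow> real) \<Rightarrow> 'a \<Rightarrow> bool" where
  "local_minimizer f x \<longleftrightarrow> (\<forall>\<^sub>F y in nhds x. f x \<le> f y)"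

definition strictly_convex_on :: "'a::real_vector set \<Rightarrow> ('a \<Rightarrow> real) \<Rightarrow> bool" where
  "strictly_convex_on S f \<longleftrightarrow> convex S \<and>
     (\<forall>x\<in>S. \<forall>y\<in>S. x \<noteq> y \<longrightarrow> (\<forall>u>0. \<forall>v>0. u + v = 1 \<longrightarrow>
        f (u *\<^sub>R x + v *\<^sub>R y) < u * f x + v * f y))"

(* The map Phi. Only its values on U matter, and only when the local minimizer in U
   exists and is unique. *)
definition imf_map ::
  "(real^'n::finite \<Rightarrow> real) \<Rightarrow> (real^'n \<Rightarrow> real^'n) \<Rightarrow> real \<Rightarrow> real \<Rightarrow> (real^'n) set \<Rightarrow>
   real^'n \<Rightarrow> real^'n" where
  "imf_map V v \<alpha> \<beta> U x =
     (THE y. y \<in> U \<and> local_minimizer (imf_objective V (v x) \<alpha> \<beta> x) y)"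

end

theory Submission
  imports Defs
begin

text \<open>Write \<open>P = v v\<^sup>T\<close> and let \<open>G x y\<close> be the gradient of \<open>y \<mapsto> L(y;x,\<alpha>,\<beta>)\<close>. At \<open>x = y = x\<^sup>*\<close> the
  Hessian of \<open>L\<close> in \<open>y\<close> acts as \<open>\<nabla>\<^sup>2V(x\<^sup>*)\<close> on the orthogonal complement of \<open>v\<close> and as
  \<open>(1 - \<alpha> - \<beta>) \<lambda> > 0\<close> on the line of \<open>v\<close>, where \<open>\<lambda> < 0\<close> is the negative eigenvalue. Since \<open>P\<close> is
  differentiable as long as the smallest eigenvalue is simple, this Hessian stays uniformly positive
  definite for \<open>x\<close>, \<open>y\<close> in a ball around \<open>x\<^sup>*\<close>, so that \<open>L\<close> is strongly convex there. Moreover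
  \<open>x \<mapsto> G x x\<^sup>*\<close> has derivative \<open>0\<close> at \<open>x\<^sup>*\<close>, because \<open>P\<close> commutes with \<open>\<nabla>\<^sup>2V(x\<^sup>*)\<close>; as the distance of
  the minimizer \<open>\<Phi>(x)\<close> to \<open>x\<^sup>*\<close> is at most a constant times \<open>\<parallel>G x x\<^sup>*\<parallel>\<close>, the minimizer over a
  smaller ball is interior and \<open>\<Phi>\<close> has derivative \<open>0\<close> at \<open>x\<^sup>*\<close>. Differentiability elsewhere
  follows by implicit differentiation of \<open>G x (\<Phi>(x)) = 0\<close>, and
  \<open>G x x = (1 - (\<alpha> + \<beta>) P) \<nabla>V(x)\<close> identifies the fixed points with the stationary points of \<open>V\<close>.\<close>

subsection \<open>Implicit differentiation and strong convexity\<close>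

text \<open>A pointwise form of implicit differentiation: a continuous solution \<open>y\<close> is
  given and \<open>G\<close> is differentiable at the single point \<open>(y x0, x0)\<close>, which
  is all that is known of the gradient of the objective once \<open>v\<close> is replaced by a local
  differentiable choice. Inverting the partial derivative in the first argument first gives a
  Lipschitz bound for \<open>y\<close> at \<open>x0\<close>; this turns the error term into
  \<open>o(x - x0)\<close>.\<close>

lemma implicit_differentiable:
  fixes G :: "'a::euclidean_space \<times> 'b::real_normed_vector \<Rightarrow> 'a" and y :: "'b \<Rightarrow> 'a"
  assumes der: "(G has_derivative D) (at (y x0, x0))"
    and inj: "\<And>k. D (k, 0) = 0 \<Longrightarrow> k = 0"
    and cont: "isCont y x0"
    and zero: "\<forall>\<^sub>F x in nhds x0. G (y x, x) = 0"
  shows "y differentiable at x0"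
proof -
  have bl: "bounded_linear D" using der by (rule has_derivative_bounded_linear)
  interpret D: bounded_linear D by (rule bl)
  have linA: "linear (\<lambda>k. D (k, 0))"
    by (rule linearI) (simp_all flip: D.add D.scaleR)
  have "inj (\<lambda>k. D (k, 0))"
    using inj linear_injective_0[OF linA] by blast
  then obtain L where linL: "linear L" and L: "L \<circ> (\<lambda>k. D (k, 0)) = id"
    using linear_injective_left_inverse[OF linA] by blast
  interpret L: bounded_linear L using linL by (simp add: linear_conv_bounded_linear)
  obtain K where K: "K > 0" "\<And>a. norm (L a) \<le> norm a * K" using L.pos_bounded by blast
  obtain M where M: "M > 0" "\<And>a. norm (D a) \<le> norm a * M" using D.pos_bounded by blast
  \<comment> \<open>\<open>L\<close> inverts the partial derivative in the first argument, so
    applying it to \<open>D\<close> isolates the increment of \<open>y\<close>.\<close>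
  have LD: "L (D (k, h)) = k + L (D (0, h))" for k h
  proof -
    have "D (k, h) = D (k, 0) + D (0, h)" by (simp flip: D.add)
    then show ?thesis using L by (simp add: L.add fun_eq_iff)
  qed
  have G0: "G (y x0, x0) = 0" using zero by (rule eventually_nhds_x_imp_x)
  have lim: "((\<lambda>x. (y x, x)) \<longlongrightarrow> (y x0, x0)) (nhds x0)"
    using cont by (intro tendsto_Pair filterlim_ident) (auto simp: isCont_def tendsto_at_iff_tendsto_nhds)
  have step: "\<forall>\<^sub>F x in nhds x0. norm (y x - y x0 + L (D (0, x - x0))) \<le> e * (norm (y x - y x0) + norm (x - x0))"
    if e: "e > 0" for e
  proof -
    have "e / K > 0" using e K by simp
    then obtain d where d: "d > 0" "\<And>p. norm (p - (y x0, x0)) < d \<Longrightarrow>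
        norm (G p - G (y x0, x0) - D (p - (y x0, x0))) \<le> e / K * norm (p - (y x0, x0))"
      using der unfolding has_derivative_at_alt by blast
    have "\<forall>\<^sub>F x in nhds x0. dist (y x, x) (y x0, x0) < d"
      using lim d(1) by (rule tendstoD)
    with zero show ?thesis
    proof eventually_elim
      case (elim x)
      have "norm (D (y x - y x0, x - x0)) \<le> e / K * norm (y x - y x0, x - x0)"
        using d(2)[of "(y x, x)"] elim G0 by (simp add: dist_norm)
      also have "\<dots> \<le> e / K * (norm (y x - y x0) + norm (x - x0))"
        using e K norm_Pair_le by (intro mult_left_mono) auto
      finally have "norm (D (y x - y x0, x - x0)) * K \<le> e * (norm (y x - y x0) + norm (x - x0))"
        using K(1) by (simp add: field_simps)
      then show ?case using K(2)[of "D (y x - y x0, x - x0)"] LD[of "y x - y x0" "x - x0"] by simp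
    qed
  qed
  \<comment> \<open>This is the constant obtained by solving
    \<open>n \<le> (n + h) / 2 + M * K * h\<close> for \<open>n\<close>, where \<open>n\<close> and
    \<open>h\<close> are the norms of the increments of \<open>y\<close> and
    \<open>x\<close>.\<close>
  define C where "C = 2 * (M * K) + 1"
  have C: "C > 0" using M K by (simp add: C_def add_pos_pos)
  have half: "(1 / 2 :: real) > 0" by simp
  have lip: "\<forall>\<^sub>F x in nhds x0. norm (y x - y x0) \<le> C * norm (x - x0)"
    using step[OF half]
  proof eventually_elim
    case (elim x)
    have "norm (L (D (0, x - x0))) \<le> norm (D (0, x - x0)) * K" by (rule K)
    also have "\<dots> \<le> (norm (x - x0) * M) * K"
      using K M(2)[of "(0, x - x0)"] by (intro mult_right_mono) (auto simp: norm_Pair)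
    finally have "norm (L (D (0, x - x0))) \<le> (M * K) * norm (x - x0)" by (simp add: mult_ac)
    moreover have "norm (y x - y x0) \<le> norm (y x - y x0 + L (D (0, x - x0))) + norm (L (D (0, x - x0)))"
      by (metis add_diff_cancel norm_triangle_ineq4)
    ultimately show ?case using elim by (simp add: C_def algebra_simps)
  qed
  have "(y has_derivative (\<lambda>h. - L (D (0, h)))) (at x0)"
    unfolding has_derivative_at_alt
  proof (intro conjI allI impI)
    have "bounded_linear (\<lambda>h. (0::'a, h::'b))"
      by (intro bounded_linear_intros)
    then show "bounded_linear (\<lambda>h. - L (D (0, h)))"
      by (intro bounded_linear_minus bounded_linear_compose[OF L.bounded_linear_axioms]
          bounded_linear_compose[OF bl])
    fix e :: real assume e: "e > 0"
    have "e / (C + 1) > 0" using e C by simp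
    from step[OF this] lip
    have "\<forall>\<^sub>F x in nhds x0. norm (y x - y x0 - (- L (D (0, x - x0)))) \<le> e * norm (x - x0)"
    proof eventually_elim
      case (elim x)
      have "e / (C + 1) * (norm (y x - y x0) + norm (x - x0)) \<le> e / (C + 1) * (C * norm (x - x0) + norm (x - x0))"
        using elim e C by (intro mult_left_mono) auto
      also have "\<dots> = e / (C + 1) * ((C + 1) * norm (x - x0))" by (simp add: algebra_simps)
      also have "\<dots> = e * norm (x - x0)" using C by simp
      finally show ?case using elim by simp
    qed
    then show "\<exists>d>0. \<forall>x. norm (x - x0) < d \<longrightarrow>
        norm (y x - y x0 - (- L (D (0, x - x0)))) \<le> e * norm (x - x0)"
      unfolding eventually_nhds_metric by (simp add: dist_norm)
  qed
  then show ?thesis by (auto simp: differentiable_def)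
qed

text \<open>Two integrations along the segment from \<open>y1\<close> to \<open>y2\<close>: the
  bound on \<open>M\<close> makes \<open>G \<bullet> d - c * t * (norm d)\<^sup>2\<close>
  nondecreasing in \<open>t\<close>, and this in turn makes \<open>p\<close> nondecreasing; the
  claim is \<open>p 0 \<le> p 1\<close>.\<close>

lemma strong_convexity_lower_bound:
  fixes f :: "'a::real_inner \<Rightarrow> real"
  assumes U: "convex U"
    and f: "\<And>y. y \<in> U \<Longrightarrow> (f has_derivative (\<lambda>h. G y \<bullet> h)) (at y)"
    and G: "\<And>y. y \<in> U \<Longrightarrow> (G has_derivative M y) (at y)"
    and M: "\<And>y k. y \<in> U \<Longrightarrow> c * (norm k)\<^sup>2 \<le> k \<bullet> M y k"
    and y: "y1 \<in> U" "y2 \<in> U"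
  shows "f y1 + G y1 \<bullet> (y2 - y1) + c / 2 * (norm (y2 - y1))\<^sup>2 \<le> f y2"
proof -
  define d where "d = y2 - y1"
  have seg: "y1 + t *\<^sub>R d \<in> U" if "0 \<le> t" "t \<le> 1" for t
    using convexD_alt[OF U y that] by (simp add: d_def algebra_simps)
  have G1: "((\<lambda>t. G (y1 + t *\<^sub>R d) \<bullet> d - c * t * (norm d)\<^sup>2) has_real_derivative
      M (y1 + t *\<^sub>R d) d \<bullet> d - c * (norm d)\<^sup>2) (at t)" if "0 \<le> t" "t \<le> 1" for t
  proof -
    have lin: "linear (M (y1 + t *\<^sub>R d))" using G[OF seg[OF that]] by (rule has_derivative_linear)
    have "((\<lambda>t. G (y1 + t *\<^sub>R d)) has_derivative (\<lambda>s. M (y1 + t *\<^sub>R d) (s *\<^sub>R d))) (at t)"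
      by (rule has_derivative_compose[where f = "\<lambda>t. y1 + t *\<^sub>R d", OF _ G[OF seg[OF that]]])
        (auto intro!: derivative_eq_intros)
    then show ?thesis unfolding has_field_derivative_def
      by (auto intro!: derivative_eq_intros simp: linear_scale[OF lin] algebra_simps)
  qed
  have mono: "G y1 \<bullet> d \<le> G (y1 + t *\<^sub>R d) \<bullet> d - c * t * (norm d)\<^sup>2" if "0 \<le> t" "t \<le> 1" for t
    using DERIV_nonneg_imp_nondecreasing[of 0 t "\<lambda>t. G (y1 + t *\<^sub>R d) \<bullet> d - c * t * (norm d)\<^sup>2"]
      G1 M[OF seg] that by (force simp: inner_commute)
  have f1: "((\<lambda>t. f (y1 + t *\<^sub>R d) - t * (G y1 \<bullet> d) - c / 2 * t\<^sup>2 * (norm d)\<^sup>2) has_real_derivative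
      G (y1 + t *\<^sub>R d) \<bullet> d - G y1 \<bullet> d - c * t * (norm d)\<^sup>2) (at t)" if "0 \<le> t" "t \<le> 1" for t
  proof -
    have "((\<lambda>t. f (y1 + t *\<^sub>R d)) has_derivative (\<lambda>s. G (y1 + t *\<^sub>R d) \<bullet> (s *\<^sub>R d))) (at t)"
      by (rule has_derivative_compose[where f = "\<lambda>t. y1 + t *\<^sub>R d", OF _ f[OF seg[OF that]]])
        (auto intro!: derivative_eq_intros)
    then show ?thesis unfolding has_field_derivative_def
      by (auto intro!: derivative_eq_intros simp: algebra_simps)
  qed
  define p where "p = (\<lambda>t. f (y1 + t *\<^sub>R d) - t * (G y1 \<bullet> d) - c / 2 * t\<^sup>2 * (norm d)\<^sup>2)"
  have "p 0 \<le> p 1"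
  proof (rule DERIV_nonneg_imp_nondecreasing[where f = p])
    fix t :: real assume t: "0 \<le> t" "t \<le> 1"
    show "\<exists>z. (p has_real_derivative z) (at t) \<and> 0 \<le> z"
      unfolding p_def using f1[OF t] mono[OF t] by (intro exI conjI) auto
  qed simp
  then show ?thesis by (simp add: d_def p_def)
qed

text \<open>The lower bound is taken at the convex combination \<open>z\<close> towards both
  endpoints and averaged: the first-order terms cancel, and the quadratic term makes the inequality
  at \<open>x\<close> strict.\<close>

lemma strictly_convex_onI_lower_bound:
  fixes f :: "'a::real_inner \<Rightarrow> real"
  assumes U: "convex U" and c: "c > 0"
    and lb: "\<And>y1 y2. y1 \<in> U \<Longrightarrow> y2 \<in> U \<Longrightarrow> f y1 + G y1 \<bullet> (y2 - y1) + c * (norm (y2 - y1))\<^sup>2 \<le> f y2"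
  shows "strictly_convex_on U f"
  unfolding strictly_convex_on_def
proof (intro conjI U ballI impI allI)
  fix x y and u v :: real
  assume *: "x \<in> U" "y \<in> U" "x \<noteq> y" "u > 0" "v > 0" "u + v = 1"
  define z where "z = u *\<^sub>R x + v *\<^sub>R y"
  have z: "z \<in> U" unfolding z_def using * by (intro convexD[OF U]) auto
  have u: "u = 1 - v" using * by simp
  have "z - x = v *\<^sub>R (y - x)" by (simp add: z_def u algebra_simps)
  moreover have "v *\<^sub>R (y - x) \<noteq> 0" using *(3,5) by simp
  ultimately have "z \<noteq> x" by force
  then have pos: "c * (norm (x - z))\<^sup>2 > 0" using c by simp
  have 0: "u *\<^sub>R (x - z) + v *\<^sub>R (y - z) = 0"
    by (simp add: z_def u algebra_simps)
  have "G z \<bullet> (u *\<^sub>R (x - z) + v *\<^sub>R (y - z)) = 0" unfolding 0 by simp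
  then have G: "u * (G z \<bullet> (x - z)) + v * (G z \<bullet> (y - z)) = 0"
    by (simp add: inner_add_right)
  have "f z + G z \<bullet> (x - z) < f x" using lb[OF z *(1)] pos by simp
  then have "u * (f z + G z \<bullet> (x - z)) < u * f x" using *(4) by (intro mult_strict_left_mono) auto
  moreover have "f z + G z \<bullet> (y - z) \<le> f y"
    using lb[OF z *(2)] c by (smt (verit) zero_le_power2 mult_nonneg_nonneg)
  then have "v * (f z + G z \<bullet> (y - z)) \<le> v * f y" using *(5) by (intro mult_left_mono) auto
  ultimately have "u * (f z + G z \<bullet> (x - z)) + v * (f z + G z \<bullet> (y - z)) < u * f x + v * f y"
    by (rule add_less_le_mono)
  moreover have "u * (f z + G z \<bullet> (x - z)) + v * (f z + G z \<bullet> (y - z)) = f z"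
    using G *(6) by algebra
  ultimately show "f (u *\<^sub>R x + v *\<^sub>R y) < u * f x + v * f y" by (simp add: z_def)
qed

subsection \<open>Quadratic forms\<close>

lemma bounded_bilinear_matrix_vector_mult: "bounded_bilinear ((*v) :: real^'n^'m \<Rightarrow> real^'n \<Rightarrow> real^'m)"
  unfolding bilinear_conv_bounded_bilinear[symmetric] bilinear_def
proof (intro conjI allI linearI)
  fix A B :: "real^'n^'m" and x y :: "real^'n" and r :: real
  show "A *v (x + y) = A *v x + A *v y" by (rule matrix_vector_right_distrib)
  show "A *v (r *\<^sub>R x) = r *\<^sub>R (A *v x)" by (rule matrix_vector_mult_scaleR)
  show "(A + B) *v x = A *v x + B *v x" by (rule matrix_vector_mult_add_rdistrib)
  show "(r *\<^sub>R A) *v x = r *\<^sub>R (A *v x)" by (simp only: scaleR_matrix_vector_assoc)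
qed

text \<open>The norm of a matrix is here the Euclidean norm of its entries, so \<open>K\<close>
  comes from the boundedness of the bilinear map \<open>*v\<close>.\<close>

lemma quadratic_form_perturbation:
  obtains K where "K > 0"
    "\<And>(A::real^'n^'n) B k. \<bar>k \<bullet> (B *v k) - k \<bullet> (A *v k)\<bar> \<le> K * norm (B - A) * (norm k)\<^sup>2"
proof -
  obtain K where K: "K > 0" "\<And>(M::real^'n^'n) k. norm (M *v k) \<le> norm M * norm k * K"
    using bounded_bilinear.pos_bounded[OF bounded_bilinear_matrix_vector_mult] by blast
  show ?thesis
  proof (rule that[OF K(1)])
    fix A B :: "real^'n^'n" and k
    have "k \<bullet> (B *v k) - k \<bullet> (A *v k) = k \<bullet> ((B - A) *v k)"
      by (simp add: matrix_vector_mult_diff_rdistrib inner_diff_right)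
    also have "\<bar>\<dots>\<bar> \<le> norm k * norm ((B - A) *v k)" by (rule Cauchy_Schwarz_ineq2)
    also have "\<dots> \<le> norm k * (norm (B - A) * norm k * K)"
      by (intro mult_left_mono K) auto
    finally show "\<bar>k \<bullet> (B *v k) - k \<bullet> (A *v k)\<bar> \<le> K * norm (B - A) * (norm k)\<^sup>2"
      by (simp add: power2_eq_square mult_ac)
  qed
qed

lemma symmetric_matrix_inner:
  fixes A :: "real^'n^'n"
  assumes "transpose A = A"
  shows "x \<bullet> (A *v y) = (A *v x) \<bullet> y"
  by (metis assms dot_lmul_matrix vector_transpose_matrix)

lemma outer_square_mult: "outer_square w *v z = (w \<bullet> z) *\<^sub>R w"
  unfolding vec_eq_iff
proof
  fix i
  have "(outer_square w *v z) $ i = (\<Sum>j\<in>UNIV. w $ i * (w $ j * z $ j))"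
    by (simp add: outer_square_def matrix_vector_mult_def mult.assoc)
  also have "\<dots> = w $ i * (\<Sum>j\<in>UNIV. w $ j * z $ j)" by (rule sum_distrib_left[symmetric])
  finally show "(outer_square w *v z) $ i = ((w \<bullet> z) *\<^sub>R w) $ i"
    by (simp add: inner_vec_def mult.commute)
qed

text \<open>First-order optimality on the sphere: the form \<open>u \<mapsto> u \<bullet> (A - \<lambda>) u\<close> is nonnegative on \<open>S\<close>
  and vanishes at \<open>w\<close>, hence so does its polar form \<open>k \<mapsto> k \<bullet> (A - \<lambda>) w\<close>.\<close>

lemma sphere_minimizer_eigenvector:
  fixes A :: "real^'n^'n"
  assumes A: "transpose A = A" and S: "subspace S" "\<And>u. u \<in> S \<Longrightarrow> A *v u \<in> S"
    and w: "w \<in> S" "norm w = 1"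
    and min: "\<And>u. u \<in> S \<Longrightarrow> norm u = 1 \<Longrightarrow> w \<bullet> (A *v w) \<le> u \<bullet> (A *v u)"
  defines "l \<equiv> w \<bullet> (A *v w)"
  shows "u \<in> S \<Longrightarrow> l * (norm u)\<^sup>2 \<le> u \<bullet> (A *v u)"
    and "A *v w = l *\<^sub>R w"
proof -
  have ge: "l * (norm u)\<^sup>2 \<le> u \<bullet> (A *v u)" if "u \<in> S" for u
  proof (cases "u = 0")
    case False
    have "l \<le> ((1 / norm u) *\<^sub>R u) \<bullet> (A *v ((1 / norm u) *\<^sub>R u))"
      unfolding l_def using False that by (intro min subspace_scale[OF S(1)]) auto
    also have "\<dots> = (u \<bullet> (A *v u)) / (norm u)\<^sup>2"
      unfolding matrix_vector_mult_scaleR inner_scaleR_left inner_scaleR_right power2_eq_square by simp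
    finally show ?thesis using False by (simp add: field_simps)
  qed simp
  then show "u \<in> S \<Longrightarrow> l * (norm u)\<^sup>2 \<le> u \<bullet> (A *v u)" .
  \<comment> \<open>The residual of the eigenvalue equation serves as its own test direction: along
    \<open>w + t *\<^sub>R k\<close> the nonnegative form equals
    \<open>2 * t * (k \<bullet> k) + t\<^sup>2 * Q\<close>, which forces the linear coefficient to
    vanish.\<close>
  define k where "k = A *v w - l *\<^sub>R w"
  have k: "k \<in> S" unfolding k_def using S w by (intro subspace_diff subspace_scale) auto
  define Q where "Q = k \<bullet> (A *v k) - l * (norm k)\<^sup>2"
  have "0 \<le> 2 * t * (k \<bullet> k) + t\<^sup>2 * Q" for t
  proof -
    have "w + t *\<^sub>R k \<in> S" using S(1) w k by (intro subspace_add subspace_scale)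
    from ge[OF this] have 0: "l * ((w + t *\<^sub>R k) \<bullet> (w + t *\<^sub>R k)) \<le> (w + t *\<^sub>R k) \<bullet> (A *v (w + t *\<^sub>R k))"
      by (simp add: power2_norm_eq_inner)
    have ww: "w \<bullet> w = 1" using w by (simp add: dot_square_norm)
    have 1: "w \<bullet> (A *v k) = k \<bullet> (A *v w)"
      using symmetric_matrix_inner[OF A, of w k] by (simp only: inner_commute)
    have 2: "k \<bullet> (A *v w) = k \<bullet> k + l * (k \<bullet> w)"
      unfolding k_def by (simp add: inner_diff_right inner_diff_left)
    have 3: "(w + t *\<^sub>R k) \<bullet> (A *v (w + t *\<^sub>R k)) = l + 2 * t * (k \<bullet> k + l * (k \<bullet> w)) + t\<^sup>2 * (k \<bullet> (A *v k))"
      unfolding matrix_vector_right_distrib matrix_vector_mult_scaleR inner_add_left inner_add_right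
        inner_scaleR_left inner_scaleR_right 1 2 l_def[symmetric] by algebra
    have 4: "(w + t *\<^sub>R k) \<bullet> (w + t *\<^sub>R k) = 1 + 2 * t * (k \<bullet> w) + t\<^sup>2 * (k \<bullet> k)"
      unfolding inner_add_left inner_add_right inner_scaleR_left inner_scaleR_right ww inner_commute[of w k]
      by algebra
    show ?thesis
      using 0 unfolding 3 4 Q_def power2_norm_eq_inner by (simp add: algebra_simps)
  qed note q = this
  have "k \<bullet> k = 0"
  proof (rule ccontr)
    assume "k \<bullet> k \<noteq> 0"
    then have kk: "k \<bullet> k > 0" by simp
    \<comment> \<open>So small that \<open>s * \<bar>Q\<bar> < k \<bullet> k\<close>: at
      \<open>t = - s\<close> the negative linear term then outweighs the quadratic one.\<close>
    define s where "s = (k \<bullet> k) / (\<bar>Q\<bar> + 1)"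
    have s: "s > 0" using kk by (simp add: s_def)
    have "s * \<bar>Q\<bar> < s * (\<bar>Q\<bar> + 1)" using s by simp
    also have "\<dots> = k \<bullet> k" by (simp add: s_def)
    finally have "s * \<bar>Q\<bar> < k \<bullet> k" .
    then have "s * Q < 2 * (k \<bullet> k)" using kk s
      by (smt (verit) mult_left_mono abs_ge_self)
    then have "s * (s * Q) < s * (2 * (k \<bullet> k))" using s by simp
    then show False using q[of "- s"] by (simp add: power2_eq_square algebra_simps)
  qed
  then show "A *v w = l *\<^sub>R w" by (simp add: k_def)
qed

subsection \<open>Gradient and Hessian\<close>

lemma differentiable_vecI:
  fixes f :: "'a::real_normed_vector \<Rightarrow> 'b::euclidean_space^'n"
  assumes "\<And>i. (\<lambda>x. f x $ i) differentiable at x"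
  shows "f differentiable at x"
  unfolding differentiable_componentwise_within[of f]
proof
  fix b :: "'b^'n" assume "b \<in> Basis"
  then obtain i u where b: "b = axis i u" by (auto simp: Basis_vec_def)
  show "(\<lambda>x. f x \<bullet> b) differentiable at x"
    unfolding b inner_axis by (intro differentiable_inner assms differentiable_const)
qed

lemma has_derivative_gradient:
  fixes f :: "real^'n::finite \<Rightarrow> real"
  assumes "f differentiable at x"
  shows "(f has_derivative (\<lambda>h. gradient f x \<bullet> h)) (at x)"
proof -
  have f: "(f has_derivative frechet_derivative f (at x)) (at x)"
    using assms by (simp flip: frechet_derivative_works)
  then have lin: "linear (frechet_derivative f (at x))" by (rule has_derivative_linear)
  have "frechet_derivative f (at x) h = gradient f x \<bullet> h" for h
  proof -
    have "frechet_derivative f (at x) h = frechet_derivative f (at x) (\<Sum>i\<in>UNIV. h $ i *\<^sub>R axis i 1)"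
      using basis_expansion[of h] by (simp add: scalar_mult_eq_scaleR)
    also have "\<dots> = (\<Sum>i\<in>UNIV. h $ i * partial_deriv i f x)"
      by (simp add: linear_sum[OF lin] linear_scale[OF lin] partial_deriv_def)
    finally show ?thesis by (simp add: gradient_def inner_vec_def mult.commute)
  qed
  then have "frechet_derivative f (at x) = (\<lambda>h. gradient f x \<bullet> h)" by blast
  with f show ?thesis by simp
qed

lemma continuously_differentiable_differentiable:
  "continuously_differentiable (Suc k) f \<Longrightarrow> f differentiable at x"
  by (simp add: differentiable_on_def)

lemma continuously_differentiable_continuous:
  "continuously_differentiable k f \<Longrightarrow> continuous_on UNIV f"
  by (cases k) (auto intro: differentiable_imp_continuous_on)

lemma gradient_differentiable:
  assumes "continuously_differentiable (Suc (Suc k)) f"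
  shows "gradient f differentiable at x"
proof (rule differentiable_vecI)
  fix i
  have "partial_deriv i f differentiable at x"
    using assms by (auto simp: differentiable_on_def)
  then show "(\<lambda>x. gradient f x $ i) differentiable at x" by (simp add: gradient_def)
qed

lemma has_derivative_hessian:
  assumes "continuously_differentiable (Suc (Suc k)) f"
  shows "(gradient f has_derivative (\<lambda>h. hessian f x *v h)) (at x)"
  using gradient_differentiable[OF assms] unfolding hessian_def jacobian_works .

lemma hessian_nth:
  assumes "continuously_differentiable (Suc (Suc k)) f"
  shows "hessian f x $ i $ j = partial_deriv j (partial_deriv i f) x"
proof -
  have "((\<lambda>x. gradient f x $ i) has_derivative (\<lambda>h. (hessian f x *v h) $ i)) (at x)"
    using bounded_linear_vec_nth has_derivative_hessian[OF assms] by (rule bounded_linear.has_derivative)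
  then have "(partial_deriv i f has_derivative (\<lambda>h. (hessian f x *v h) $ i)) (at x)"
    by (simp add: gradient_def)
  from frechet_derivative_at[OF this]
  have "partial_deriv j (partial_deriv i f) x = (hessian f x *v axis j 1) $ i"
    by (simp add: partial_deriv_def fun_eq_iff)
  then show ?thesis by (simp add: matrix_vector_mul_component inner_axis)
qed

lemma hessian_differentiable:
  assumes "continuously_differentiable (Suc (Suc (Suc k))) f"
  shows "hessian f differentiable at x"
proof (intro differentiable_vecI)
  fix i j
  have "partial_deriv j (partial_deriv i f) differentiable at x"
    using assms by (auto simp: differentiable_on_def)
  then show "(\<lambda>x. hessian f x $ i $ j) differentiable at x"
    by (simp add: hessian_nth[OF assms])
qed

lemma partial_deriv_line:
  fixes f :: "real^'n::finite \<Rightarrow> real"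
  assumes "f differentiable at (p + t *\<^sub>R axis i 1)"
  shows "((\<lambda>t. f (p + t *\<^sub>R axis i 1)) has_real_derivative partial_deriv i f (p + t *\<^sub>R axis i 1)) (at t)"
proof -
  have "((\<lambda>t. f (p + t *\<^sub>R axis i 1)) has_derivative
      (\<lambda>s. gradient f (p + t *\<^sub>R axis i 1) \<bullet> (s *\<^sub>R axis i 1))) (at t)"
    by (rule has_derivative_compose[where f = "\<lambda>t. p + t *\<^sub>R axis i 1", OF _ has_derivative_gradient[OF assms]])
      (auto intro!: derivative_eq_intros)
  then show ?thesis unfolding has_field_derivative_def
    by (rule has_derivative_eq_rhs) (simp add: inner_axis gradient_def fun_eq_iff mult.commute)
qed

text \<open>The second difference is symmetric in \<open>i\<close> and \<open>j\<close>, which yields the symmetry of the Hessian.\<close>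

lemma second_difference_mixed_partial:
  fixes f :: "real^'n::finite \<Rightarrow> real"
  assumes f: "continuously_differentiable (Suc (Suc k)) f" and t: "t > 0"
  obtains p where "norm (p - x) < 2 * t"
    "f (x + t *\<^sub>R axis i 1 + t *\<^sub>R axis j 1) - f (x + t *\<^sub>R axis i 1) - f (x + t *\<^sub>R axis j 1) + f x =
      t * (t * partial_deriv j (partial_deriv i f) p)"
proof -
  note d = continuously_differentiable_differentiable[OF f]
  have d2: "partial_deriv i f differentiable at p" for p
    using f by (auto simp: differentiable_on_def)
  \<comment> \<open>The second difference is the increment of this function of \<open>a\<close> from
    \<open>0\<close> to \<open>t\<close>. The mean value theorem is applied in direction
    \<open>i\<close>, then to the resulting difference in direction \<open>j\<close>.\<close>
  have 1: "((\<lambda>a. f ((x + t *\<^sub>R axis j 1) + a *\<^sub>R axis i 1) - f (x + a *\<^sub>R axis i 1)) has_real_derivative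
     partial_deriv i f ((x + t *\<^sub>R axis j 1) + a *\<^sub>R axis i 1) - partial_deriv i f (x + a *\<^sub>R axis i 1)) (at a)" for a
    by (intro DERIV_diff partial_deriv_line d)
  obtain a where a: "0 < a" "a < t"
    "(f ((x + t *\<^sub>R axis j 1) + t *\<^sub>R axis i 1) - f (x + t *\<^sub>R axis i 1)) -
     (f ((x + t *\<^sub>R axis j 1) + 0 *\<^sub>R axis i 1) - f (x + 0 *\<^sub>R axis i 1)) = (t - 0) *
     (partial_deriv i f ((x + t *\<^sub>R axis j 1) + a *\<^sub>R axis i 1) - partial_deriv i f (x + a *\<^sub>R axis i 1))"
    using MVT2[OF t 1] by blast
  have 2: "((\<lambda>b. partial_deriv i f ((x + a *\<^sub>R axis i 1) + b *\<^sub>R axis j 1)) has_real_derivative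
     partial_deriv j (partial_deriv i f) ((x + a *\<^sub>R axis i 1) + b *\<^sub>R axis j 1)) (at b)" for b
    by (intro partial_deriv_line d2)
  obtain b where b: "0 < b" "b < t"
    "partial_deriv i f ((x + a *\<^sub>R axis i 1) + t *\<^sub>R axis j 1) - partial_deriv i f ((x + a *\<^sub>R axis i 1) + 0 *\<^sub>R axis j 1)
     = (t - 0) * partial_deriv j (partial_deriv i f) ((x + a *\<^sub>R axis i 1) + b *\<^sub>R axis j 1)"
    using MVT2[OF t 2] by blast
  show ?thesis
  proof (rule that[of "(x + a *\<^sub>R axis i 1) + b *\<^sub>R axis j 1"])
    have "norm (a *\<^sub>R axis i 1 + b *\<^sub>R axis j (1::real)) \<le> a + b"
      using a b by (intro norm_triangle_le) (simp add: norm_axis_1)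
    then show "norm ((x + a *\<^sub>R axis i 1) + b *\<^sub>R axis j 1 - x) < 2 * t"
      using a b by (simp add: add.assoc)
    show "f (x + t *\<^sub>R axis i 1 + t *\<^sub>R axis j 1) - f (x + t *\<^sub>R axis i 1) - f (x + t *\<^sub>R axis j 1) + f x =
      t * (t * partial_deriv j (partial_deriv i f) ((x + a *\<^sub>R axis i 1) + b *\<^sub>R axis j 1))"
      using a(3) b(3) by (simp add: add.commute add.left_commute)
  qed
qed

text \<open>Schwarz's theorem: one second difference equals \<open>t * t\<close> times either mixed
  partial at points within \<open>2 * t\<close> of \<open>x\<close>. Were the values at
  \<open>x\<close> different, continuity would keep the two mixed partials in disjoint balls of
  radius \<open>e\<close>, half the gap.\<close>

lemma mixed_partials_commute:
  fixes f :: "real^'n::finite \<Rightarrow> real"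
  assumes f: "continuously_differentiable (Suc (Suc k)) f"
  shows "partial_deriv j (partial_deriv i f) x = partial_deriv i (partial_deriv j f) x"
proof (rule ccontr)
  let ?D = "\<lambda>i j. partial_deriv j (partial_deriv i f)"
  assume ne: "?D i j x \<noteq> ?D j i x"
  define e where "e = \<bar>?D i j x - ?D j i x\<bar> / 2"
  have e: "e > 0" using ne by (simp add: e_def)
  have cont: "isCont (?D i j) x" for i j
  proof -
    have "continuous_on UNIV (?D i j)" using f by (auto intro: continuously_differentiable_continuous)
    then show ?thesis by (simp add: continuous_on_eq_continuous_at)
  qed
  obtain d1 where d1: "d1 > 0" "\<And>p. dist p x < d1 \<Longrightarrow> dist (?D i j p) (?D i j x) < e"
    using cont[where i = i and j = j] e unfolding continuous_at_eps_delta by (auto simp: dist_norm)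
  obtain d2 where d2: "d2 > 0" "\<And>p. dist p x < d2 \<Longrightarrow> dist (?D j i p) (?D j i x) < e"
    using cont[where i = j and j = i] e unfolding continuous_at_eps_delta by (auto simp: dist_norm)
  define t where "t = min d1 d2 / 2"
  have t: "t > 0" "2 * t \<le> d1" "2 * t \<le> d2" using d1 d2 by (auto simp: t_def)
  obtain p where p: "norm (p - x) < 2 * t"
    "f (x + t *\<^sub>R axis i 1 + t *\<^sub>R axis j 1) - f (x + t *\<^sub>R axis i 1) - f (x + t *\<^sub>R axis j 1) + f x =
      t * (t * ?D i j p)"
    using second_difference_mixed_partial[OF f t(1)] .
  obtain q where q: "norm (q - x) < 2 * t"
    "f (x + t *\<^sub>R axis j 1 + t *\<^sub>R axis i 1) - f (x + t *\<^sub>R axis j 1) - f (x + t *\<^sub>R axis i 1) + f x =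
      t * (t * ?D j i q)"
    using second_difference_mixed_partial[OF f t(1)] .
  have "x + t *\<^sub>R axis j 1 + t *\<^sub>R axis i 1 = x + t *\<^sub>R axis i 1 + t *\<^sub>R axis j (1::real)"
    by (simp add: add_ac)
  then have "t * (t * ?D i j p) = t * (t * ?D j i q)"
    unfolding p(2)[symmetric] q(2)[symmetric] by (simp add: add_ac)
  then have eq: "?D i j p = ?D j i q" using t by simp
  have 1: "dist (?D i j p) (?D i j x) < e" using d1(2)[of p] p(1) t by (simp add: dist_norm)
  have 2: "dist (?D j i q) (?D j i x) < e" using d2(2)[of q] q(1) t by (simp add: dist_norm)
  have "dist (?D i j x) (?D j i x) < e + e"
    using dist_triangle_less_add[of "?D i j x" "?D i j p" e "?D j i x" e] 1 2 eq by (simp add: dist_commute)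
  then show False by (simp add: e_def dist_real_def)
qed

lemma hessian_symmetric:
  assumes f: "continuously_differentiable (Suc (Suc k)) f"
  shows "transpose (hessian f x) = hessian f x"
  by (simp add: vec_eq_iff transpose_def hessian_nth[OF f] mixed_partials_commute[OF f])

subsection \<open>The smallest eigenvalue of a symmetric matrix\<close>

text \<open>The quadratic form attains its minimum on the compact unit sphere of \<open>S\<close>.
  Applied with \<open>S\<close> the orthogonal complement of an eigenvector, it provides the next
  eigenvalue without the full spectral theorem.\<close>

lemma symmetric_subspace_minimal_eigenvector:
  fixes A :: "real^'n^'n"
  assumes A: "transpose A = A" and S: "subspace S" "\<And>u. u \<in> S \<Longrightarrow> A *v u \<in> S"
    and ne: "k \<in> S" "k \<noteq> 0"
  obtains z where "z \<in> S" "norm z = 1" "A *v z = (z \<bullet> (A *v z)) *\<^sub>R z"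
    "\<And>u. u \<in> S \<Longrightarrow> (z \<bullet> (A *v z)) * (norm u)\<^sup>2 \<le> u \<bullet> (A *v u)"
proof -
  have comp: "compact (sphere 0 1 \<inter> S)" using closed_subspace[OF S(1)] by (intro compact_Int_closed) auto
  have "(1 / norm k) *\<^sub>R k \<in> sphere 0 1 \<inter> S" using ne S(1) by (auto intro: subspace_scale)
  then have nonempty: "sphere 0 1 \<inter> S \<noteq> {}" by blast
  have "continuous_on (sphere 0 1 \<inter> S) (\<lambda>u. u \<bullet> (A *v u))"
    by (intro continuous_intros matrix_vector_mult_linear_continuous_on)
  from continuous_attains_inf[OF comp nonempty this]
  obtain z where z: "z \<in> sphere 0 1 \<inter> S" "\<And>u. u \<in> sphere 0 1 \<inter> S \<Longrightarrow> z \<bullet> (A *v z) \<le> u \<bullet> (A *v u)"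
    by blast
  have z1: "z \<in> S" "norm z = 1" using z(1) by auto
  have min: "z \<bullet> (A *v z) \<le> u \<bullet> (A *v u)" if "u \<in> S" "norm u = 1" for u using z(2) that by auto
  show ?thesis
    by (rule that[OF z1 sphere_minimizer_eigenvector(2)[OF A S z1 min] sphere_minimizer_eigenvector(1)[OF A S z1 min]])
qed

lemma arg_min_sphere_eigenvector:
  fixes A :: "real^'n^'n"
  assumes A: "transpose A = A" and w: "is_arg_min (\<lambda>u. u \<bullet> (A *v u)) (\<lambda>u. norm u = 1) w"
  shows "norm w = 1" "A *v w = (w \<bullet> (A *v w)) *\<^sub>R w" "(w \<bullet> (A *v w)) * (norm u)\<^sup>2 \<le> u \<bullet> (A *v u)"
proof -
  show 1: "norm w = 1" using w by (simp add: is_arg_min_def)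
  have min: "w \<bullet> (A *v w) \<le> u \<bullet> (A *v u)" if "u \<in> UNIV" "norm u = 1" for u
    using w that by (auto simp: is_arg_min_def not_less)
  show "A *v w = (w \<bullet> (A *v w)) *\<^sub>R w"
    by (rule sphere_minimizer_eigenvector(2)[OF A subspace_UNIV UNIV_I UNIV_I 1 min])
  show "(w \<bullet> (A *v w)) * (norm u)\<^sup>2 \<le> u \<bullet> (A *v u)"
    by (rule sphere_minimizer_eigenvector(1)[OF A subspace_UNIV UNIV_I UNIV_I 1 min UNIV_I])
qed

lemma subspace_orthogonal: "subspace {k. w \<bullet> k = 0}"
  by (rule subspaceI) (auto simp: inner_add_right)

lemma orthogonal_eigenvector_invariant:
  fixes A :: "real^'n^'n"
  assumes "transpose A = A" "A *v w = l *\<^sub>R w" "w \<bullet> k = 0"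
  shows "w \<bullet> (A *v k) = 0"
  by (simp add: symmetric_matrix_inner[OF assms(1), of w k] assms(2,3))

text \<open>The minimum of the form on the unit sphere of the complement of \<open>w\<close> is
  attained at an eigenvector \<open>z\<close>. If it equalled the smallest eigenvalue,
  \<open>z\<close> would contradict simplicity, so \<open>g\<close> is the difference of the two
  values. In dimension one the complement is trivial.\<close>

lemma simple_eigenvalue_gap:
  fixes A :: "real^'n^'n"
  assumes A: "transpose A = A" and w: "is_arg_min (\<lambda>u. u \<bullet> (A *v u)) (\<lambda>u. norm u = 1) w"
    and simple: "\<And>k. w \<bullet> k = 0 \<Longrightarrow> A *v k = (w \<bullet> (A *v w)) *\<^sub>R k \<Longrightarrow> k = 0"
  obtains g where "g > 0" "\<And>k. w \<bullet> k = 0 \<Longrightarrow> (w \<bullet> (A *v w) + g) * (norm k)\<^sup>2 \<le> k \<bullet> (A *v k)"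
proof (cases "\<exists>k. w \<bullet> k = 0 \<and> k \<noteq> 0")
  case False
  then have "(w \<bullet> (A *v w) + 1) * (norm k)\<^sup>2 \<le> k \<bullet> (A *v k)" if "w \<bullet> k = 0" for k
  proof -
    have "k = 0" using False that by blast
    then show ?thesis by simp
  qed
  then show ?thesis using that[of 1] by simp
next
  case True
  note e = arg_min_sphere_eigenvector[OF A w]
  let ?S = "{k. w \<bullet> k = 0}"
  obtain k where k: "k \<in> ?S" "k \<noteq> 0" using True by blast
  have inv: "A *v u \<in> ?S" if "u \<in> ?S" for u
    using orthogonal_eigenvector_invariant[OF A e(2)] that by simp
  obtain z where z: "z \<in> ?S" "norm z = 1" "A *v z = (z \<bullet> (A *v z)) *\<^sub>R z"
    "\<And>u. u \<in> ?S \<Longrightarrow> (z \<bullet> (A *v z)) * (norm u)\<^sup>2 \<le> u \<bullet> (A *v u)"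
    using symmetric_subspace_minimal_eigenvector[OF A subspace_orthogonal inv k] by blast
  have "w \<bullet> (A *v w) \<le> z \<bullet> (A *v z)" using e(3)[of z] z(2) by simp
  moreover have "w \<bullet> (A *v w) \<noteq> z \<bullet> (A *v z)"
  proof
    assume "w \<bullet> (A *v w) = z \<bullet> (A *v z)"
    then have "z = 0" using simple[of z] z(1,3) by simp
    then show False using z(2) by simp
  qed
  ultimately have "z \<bullet> (A *v z) - w \<bullet> (A *v w) > 0" by simp
  then show ?thesis by (rule that) (use z(4) in simp)
qed

text \<open>The eigenvector is determined only up to sign, so near \<open>x0\<close> it is rescaled to \<open>u x\<close> with
  \<open>v x0 \<bullet> u x = 1\<close>; then \<open>u\<close> is a zero of the map \<open>G\<close> below, whose partial derivative in \<open>u\<close> is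
  injective because of the multiple \<open>l + 1\<close> (any factor other than \<open>l\<close> would do) in the normalizing term.\<close>

lemma minimal_eigenvector_differentiable:
  fixes A :: "real^'m \<Rightarrow> real^'n^'n" and v :: "real^'m \<Rightarrow> real^'n"
  assumes sym: "\<And>x. transpose (A x) = A x"
    and v: "\<And>x. is_arg_min (\<lambda>u. u \<bullet> (A x *v u)) (\<lambda>u. norm u = 1) (v x)"
    and diff: "A differentiable at x0"
    and simple: "\<And>k. v x0 \<bullet> k = 0 \<Longrightarrow> A x0 *v k = (v x0 \<bullet> (A x0 *v v x0)) *\<^sub>R k \<Longrightarrow> k = 0"
  obtains w where "w differentiable at x0" "w x0 = v x0"
    "\<forall>\<^sub>F x in nhds x0. norm (w x) = 1 \<and> outer_square (w x) = outer_square (v x)"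
proof -
  define v0 l c u where "v0 = v x0" and "l = v0 \<bullet> (A x0 *v v0)"
    and "c = (\<lambda>x. v0 \<bullet> v x)" and "u = (\<lambda>x. (1 / c x) *\<^sub>R v x)"
  note e = arg_min_sphere_eigenvector[OF sym v]
  note e0 = e[of x0, folded v0_def, folded l_def]
  have c0: "c x0 = 1" using e0(1) by (simp add: c_def v0_def[symmetric] dot_square_norm)
  have u0: "u x0 = v0" by (simp add: u_def c0 v0_def)
  obtain g where g: "g > 0" "\<And>k. v0 \<bullet> k = 0 \<Longrightarrow> (l + g) * (norm k)\<^sup>2 \<le> k \<bullet> (A x0 *v k)"
    using simple_eigenvalue_gap[OF sym v simple] unfolding v0_def l_def by blast
  obtain K where K: "K > 0"
    "\<And>(M::real^'n^'n) N k. \<bar>k \<bullet> (N *v k) - k \<bullet> (M *v k)\<bar> \<le> K * norm (N - M) * (norm k)\<^sup>2"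
    by (rule quadratic_form_perturbation) blast
  have form: "\<bar>k \<bullet> (A x *v k) - k \<bullet> (A x0 *v k)\<bar> \<le> K * norm (A x - A x0)" if "norm k = 1" for k x
    using K(2)[of k "A x" "A x0"] that by simp
  \<comment> \<open>The left side is the squared length of the part of \<open>v x\<close> orthogonal
    to \<open>v0\<close>. By the gap it raises the form of \<open>A x0\<close> at \<open>v x\<close>
    above \<open>l\<close> by at least \<open>g\<close> times its size, while minimality of
    \<open>v x\<close> for \<open>A x\<close> allows a rise of at most twice the perturbation of the
    form.\<close>
  have bound: "1 - (c x)\<^sup>2 \<le> 2 * K / g * norm (A x - A x0)" for x
  proof -
    define q where "q = v x - c x *\<^sub>R v0"
    have vv: "v0 \<bullet> v0 = 1" "v x \<bullet> v x = 1" using e0(1) e(1)[of x] by (simp_all add: dot_square_norm)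
    have q0: "v0 \<bullet> q = 0" by (simp add: q_def inner_diff_right vv c_def)
    have vx: "v x = c x *\<^sub>R v0 + q" by (simp add: q_def)
    have nq: "(norm q)\<^sup>2 = 1 - (c x)\<^sup>2"
      unfolding power2_norm_eq_inner q_def inner_diff_left inner_diff_right inner_scaleR_left
        inner_scaleR_right vv inner_commute[of "v x" v0] c_def[symmetric]
      using c_def by (simp add: power2_eq_square)
    have "q \<bullet> v0 = 0" using q0 by (simp add: inner_commute)
    moreover have "v0 \<bullet> (A x0 *v q) = 0"
      by (rule orthogonal_eigenvector_invariant[OF sym e0(2) q0])
    ultimately have "v x \<bullet> (A x0 *v v x) = l * (c x)\<^sup>2 + q \<bullet> (A x0 *v q)"
      unfolding vx matrix_vector_right_distrib matrix_vector_mult_scaleR inner_add_left inner_add_right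
        inner_scaleR_left inner_scaleR_right e0(2) vv
      by (simp add: power2_eq_square)
    then have "l * (c x)\<^sup>2 + (l + g) * (1 - (c x)\<^sup>2) \<le> v x \<bullet> (A x0 *v v x)"
      using g(2)[OF q0] nq by simp
    moreover have "v x \<bullet> (A x0 *v v x) \<le> v x \<bullet> (A x *v v x) + K * norm (A x - A x0)"
      using form[of "v x" x] e(1)[of x] by linarith
    moreover have "v x \<bullet> (A x *v v x) \<le> v0 \<bullet> (A x *v v0)"
      using e(3)[of x v0] e0(1) by simp
    moreover have "v0 \<bullet> (A x *v v0) \<le> l + K * norm (A x - A x0)"
      using form[of v0 x] e0(1) l_def by linarith
    ultimately have "g * (1 - (c x)\<^sup>2) \<le> 2 * K * norm (A x - A x0)"
      by (simp add: algebra_simps)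
    then show ?thesis using g(1) by (simp add: field_simps)
  qed
  have cle: "(c x)\<^sup>2 \<le> 1" for x
  proof -
    have "\<bar>c x\<bar> \<le> 1" using Cauchy_Schwarz_ineq2[of v0 "v x"] e0(1) e(1)[of x] by (simp add: c_def)
    then show ?thesis by (simp add: abs_square_le_1)
  qed
  have contA: "(A \<longlongrightarrow> A x0) (at x0)"
    using differentiable_imp_continuous_within[OF diff] by (simp add: isCont_def)
  have lim0: "((\<lambda>x. 2 * K / g * norm (A x - A x0)) \<longlongrightarrow> 0) (at x0)"
    using contA g(1) by (auto intro!: tendsto_eq_intros)
  have "((\<lambda>x. 1 - (c x)\<^sup>2) \<longlongrightarrow> 0) (at x0)"
  proof (rule tendsto_sandwich[OF _ _ tendsto_const lim0])
    show "\<forall>\<^sub>F x in at x0. 0 \<le> 1 - (c x)\<^sup>2" using cle by simp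
    show "\<forall>\<^sub>F x in at x0. 1 - (c x)\<^sup>2 \<le> 2 * K / g * norm (A x - A x0)"
      by (intro always_eventually allI bound)
  qed
  from tendsto_diff[OF tendsto_const this, of 1] have c2: "((\<lambda>x. (c x)\<^sup>2) \<longlongrightarrow> 1) (at x0)" by simp
  \<comment> \<open>Only where \<open>c x \<noteq> 0\<close> is \<open>u x\<close> a multiple of
    \<open>v x\<close> with \<open>v0 \<bullet> u x = 1\<close>; elsewhere division by zero makes it
    \<open>0\<close>.\<close>
  have cnz: "\<forall>\<^sub>F x in nhds x0. c x \<noteq> 0"
  proof -
    have "\<forall>\<^sub>F x in at x0. (c x)\<^sup>2 > 0" using c2 by (rule order_tendstoD) simp
    then show ?thesis unfolding eventually_nhds_conv_at using c0 by (auto elim: eventually_mono)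
  qed
  have nu: "(norm (u x - v0))\<^sup>2 = (1 - (c x)\<^sup>2) / (c x)\<^sup>2" if "c x \<noteq> 0" for x
  proof -
    have vv: "v0 \<bullet> v0 = 1" "v x \<bullet> v x = 1" using e0(1) e(1)[of x] by (simp_all add: dot_square_norm)
    have "(norm (u x - v0))\<^sup>2 = (1 / c x)\<^sup>2 - 2 * (1 / c x) * (v0 \<bullet> v x) + 1"
      unfolding power2_norm_eq_inner u_def inner_diff_left inner_diff_right inner_scaleR_left
        inner_scaleR_right vv inner_commute[of "v x" v0] using that by (simp add: power2_eq_square field_simps)
    also have "\<dots> = (1 / c x)\<^sup>2 - 1" using that by (simp add: c_def)
    finally show ?thesis using that by (simp add: field_simps)
  qed
  have contu: "isCont u x0"
  proof -
    have "((\<lambda>x. (1 - (c x)\<^sup>2) / (c x)\<^sup>2) \<longlongrightarrow> (1 - 1) / 1) (at x0)"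
      by (intro tendsto_intros c2) simp
    moreover have "\<forall>\<^sub>F x in at x0. (1 - (c x)\<^sup>2) / (c x)\<^sup>2 = (norm (u x - v0))\<^sup>2"
      using cnz unfolding eventually_nhds_conv_at by (auto simp: nu elim: eventually_mono)
    ultimately have "((\<lambda>x. (norm (u x - v0))\<^sup>2) \<longlongrightarrow> (1 - 1) / 1) (at x0)"
      by (rule Lim_transform_eventually)
    from tendsto_real_sqrt[OF this] have "((\<lambda>x. norm (u x - v0)) \<longlongrightarrow> 0) (at x0)"
      by (simp only: real_sqrt_abs abs_norm_cancel diff_self div_0 real_sqrt_zero)
    then show ?thesis unfolding isCont_def u0 by (simp add: tendsto_norm_zero_iff LIM_zero_iff)
  qed
  \<comment> \<open>Under the normalization \<open>v0 \<bullet> u = 1\<close> the eigenvalue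
    belonging to \<open>u\<close> is \<open>v0 \<bullet> (A *v u)\<close>; this eliminates it and
    leaves \<open>u\<close> as the only unknown.\<close>
  define G where "G = (\<lambda>p. A (snd p) *v fst p - (v0 \<bullet> (A (snd p) *v fst p)) *\<^sub>R fst p
      + ((l + 1) * (v0 \<bullet> fst p - 1)) *\<^sub>R v0)"
  obtain A' where A': "(A has_derivative A') (at x0)" using diff by (auto simp: differentiable_def)
  have A'0: "A' 0 = 0" using A' has_derivative_linear linear_0 by blast
  note mv = bounded_bilinear.FDERIV[OF bounded_bilinear_matrix_vector_mult]
  have dA: "((\<lambda>p. A (snd p)) has_derivative (\<lambda>q. A' (snd q))) (at (v0, x0))"
    by (rule has_derivative_compose[where f = snd, OF has_derivative_snd[OF has_derivative_ident]]) (simp add: A')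
  have dAu: "((\<lambda>p. A (snd p) *v fst p) has_derivative (\<lambda>q. A x0 *v fst q + A' (snd q) *v v0)) (at (v0, x0))"
    using mv[OF dA has_derivative_fst[OF has_derivative_ident]] by simp
  have udiff: "u differentiable at x0"
  proof (rule implicit_differentiable)
    show "(G has_derivative (\<lambda>q. (A x0 *v fst q + A' (snd q) *v v0)
       - ((v0 \<bullet> (A x0 *v v0)) *\<^sub>R fst q + (v0 \<bullet> (A x0 *v fst q + A' (snd q) *v v0)) *\<^sub>R v0)
       + ((l + 1) * (v0 \<bullet> fst q)) *\<^sub>R v0)) (at (u x0, x0))"
      unfolding G_def u0 by (auto intro!: derivative_eq_intros dAu)
  next
    fix k assume k: "(A x0 *v fst (k, 0) + A' (snd (k, 0)) *v v0)
       - ((v0 \<bullet> (A x0 *v v0)) *\<^sub>R fst (k, 0) + (v0 \<bullet> (A x0 *v fst (k, 0) + A' (snd (k, 0)) *v v0)) *\<^sub>R v0)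
       + ((l + 1) * (v0 \<bullet> fst (k, 0))) *\<^sub>R v0 = 0"
    have "v0 \<bullet> (A x0 *v k) = (A x0 *v v0) \<bullet> k" by (rule symmetric_matrix_inner[OF sym])
    also have "\<dots> = l * (v0 \<bullet> k)" by (subst e0(2)) simp
    finally have s: "v0 \<bullet> (A x0 *v k) = l * (v0 \<bullet> k)" .
    have k: "A x0 *v k - l *\<^sub>R k - (l * (v0 \<bullet> k)) *\<^sub>R v0 + ((l + 1) * (v0 \<bullet> k)) *\<^sub>R v0 = 0"
      using k by (simp add: A'0 l_def[symmetric] s algebra_simps)
    then have k2: "A x0 *v k - l *\<^sub>R k + (v0 \<bullet> k) *\<^sub>R v0 = 0"
      by (simp add: algebra_simps)
    \<comment> \<open>By symmetry the range of \<open>A x0 - l\<close> is orthogonal to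
      \<open>v0\<close>, so this pairing leaves just \<open>v0 \<bullet> k\<close>.\<close>
    then have "v0 \<bullet> (A x0 *v k - l *\<^sub>R k + (v0 \<bullet> k) *\<^sub>R v0) = 0" by simp
    then have vk: "v0 \<bullet> k = 0" using e0(1) by (simp add: inner_add_right inner_diff_right s dot_square_norm)
    with k2 have "A x0 *v k = l *\<^sub>R k" by simp
    with vk show "k = 0" using simple[of k] by (simp add: v0_def l_def)
  next
    show "isCont u x0" by (rule contu)
  next
    show "\<forall>\<^sub>F x in nhds x0. G (u x, x) = 0"
      using cnz
    proof eventually_elim
      case (elim x)
      define lx where "lx = v x \<bullet> (A x *v v x)"
      have "A x *v v x = lx *\<^sub>R v x" unfolding lx_def by (rule e(2))
      then have Au: "A x *v u x = lx *\<^sub>R u x"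
        by (simp add: u_def matrix_vector_mult_scaleR)
      have "v0 \<bullet> u x = 1" using elim by (simp add: u_def c_def)
      then show ?case by (simp add: G_def Au)
    qed
  qed
  \<comment> \<open>Back to unit length: \<open>w x\<close> is \<open>v x\<close> times the sign of
    \<open>c x\<close>, and \<open>outer_square\<close> does not see the sign.\<close>
  define w where "w = (\<lambda>x. (1 / norm (u x)) *\<^sub>R u x)"
  have v0nz: "v0 \<noteq> 0" using e0(1) by auto
  show ?thesis
  proof (rule that[of w])
    have nd: "(norm \<circ> u) differentiable at x0"
      using v0nz by (intro differentiable_chain_at udiff) (simp add: u0)
    show "w differentiable at x0" unfolding w_def
      using nd v0nz by (intro differentiable_scaleR differentiable_divide udiff) (simp_all add: o_def u0)
    show "w x0 = v x0" using e0(1) by (simp add: w_def u0 v0_def)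
    show "\<forall>\<^sub>F x in nhds x0. norm (w x) = 1 \<and> outer_square (w x) = outer_square (v x)"
      using cnz
    proof eventually_elim
      case (elim x)
      have "w x = (\<bar>c x\<bar> / c x) *\<^sub>R v x" using elim e(1)[of x] by (simp add: w_def u_def)
      then have "w x = v x \<or> w x = - v x" using elim by (auto simp: abs_if)
      then show ?case using e(1)[of x] by (auto simp: outer_square_def)
    qed
  qed
qed

subsection \<open>The saddle point and the objective function\<close>

text \<open>The minimum of the form on the sphere is an eigenvalue and at most \<open>l < 0\<close>,
  hence it is \<open>l\<close>. The least eigenvalue on the complement of \<open>w\<close> cannot be
  \<open>l\<close> again, as that would put two independent vectors into a one-dimensional
  eigenspace, so it is positive.\<close>

lemma index1_saddle_spectrum:
  fixes A :: "real^'n^'n"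
  assumes A: "transpose A = A" and w: "is_arg_min (\<lambda>u. u \<bullet> (A *v u)) (\<lambda>u. norm u = 1) w"
    and l: "l < 0" "eigenvalue A l" "dim (eigenspace A l) = 1"
    and pos: "\<And>m. eigenvalue A m \<Longrightarrow> m \<noteq> l \<Longrightarrow> m > 0"
  shows "A *v w = l *\<^sub>R w"
    and "\<exists>m>0. \<forall>k. w \<bullet> k = 0 \<longrightarrow> m * (norm k)\<^sup>2 \<le> k \<bullet> (A *v k)"
proof -
  note e = arg_min_sphere_eigenvector[OF A w]
  define l' where "l' = w \<bullet> (A *v w)"
  have w0: "w \<noteq> 0" using e(1) by auto
  obtain u where u: "u \<noteq> 0" "A *v u = l *\<^sub>R u"
    using l(2) by (auto simp: eigenvalue_def eigenspace_def)
  have "l' * (norm u)\<^sup>2 \<le> l * (norm u)\<^sup>2"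
    using e(3)[of u] u(2) by (simp add: l'_def power2_norm_eq_inner)
  then have "l' \<le> l" using u(1) by simp
  moreover have "eigenvalue A l'"
    unfolding eigenvalue_def eigenspace_def mem_Collect_eq l'_def using e(2) w0 by blast
  ultimately have "l' = l" using pos[of l'] l(1) by force
  then show Aw: "A *v w = l *\<^sub>R w" using e(2) by (simp add: l'_def)
  let ?S = "{k. w \<bullet> k = 0}"
  show "\<exists>m>0. \<forall>k. w \<bullet> k = 0 \<longrightarrow> m * (norm k)\<^sup>2 \<le> k \<bullet> (A *v k)"
  proof (cases "\<exists>k. w \<bullet> k = 0 \<and> k \<noteq> 0")
    case False
    then have "1 * (norm k)\<^sup>2 \<le> k \<bullet> (A *v k)" if "w \<bullet> k = 0" for k
    proof -
      have "k = 0" using False that by blast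
      then show ?thesis by simp
    qed
    then show ?thesis using zero_less_one by blast
  next
    case True
    then obtain k where k: "k \<in> ?S" "k \<noteq> 0" by blast
    have inv: "A *v u \<in> ?S" if "u \<in> ?S" for u
      using orthogonal_eigenvector_invariant[OF A Aw] that by simp
    obtain z where z: "z \<in> ?S" "norm z = 1" "A *v z = (z \<bullet> (A *v z)) *\<^sub>R z"
      "\<And>u. u \<in> ?S \<Longrightarrow> (z \<bullet> (A *v z)) * (norm u)\<^sup>2 \<le> u \<bullet> (A *v u)"
      using symmetric_subspace_minimal_eigenvector[OF A subspace_orthogonal inv k] by blast
    have z0: "z \<noteq> 0" using z(2) by auto
    have "eigenvalue A (z \<bullet> (A *v z))"
      unfolding eigenvalue_def eigenspace_def mem_Collect_eq using z(3) z0 by blast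
    moreover have "z \<bullet> (A *v z) \<noteq> l"
    proof
      assume "z \<bullet> (A *v z) = l"
      then have "{w, z} \<subseteq> eigenspace A l" using z(3) Aw by (simp add: eigenspace_def)
      moreover have "independent {w, z}"
        using z(1) w0 z0 by (intro pairwise_orthogonal_independent)
          (auto simp: pairwise_def orthogonal_def inner_commute)
      ultimately have "card {w, z} \<le> dim (eigenspace A l)" by (rule independent_card_le_dim)
      moreover have "w \<noteq> z" using z(1) w0 by auto
      ultimately show False using l(3) by simp
    qed
    ultimately have "z \<bullet> (A *v z) > 0" by (rule pos)
    then show ?thesis using z(4) by blast
  qed
qed

text \<open>The second derivative of the objective in direction \<open>k\<close>, with the Hessians
  of \<open>V\<close> at its three arguments turned into independent matrices, so that positivity
  becomes an open condition on \<open>(w, H1, H2, H3)\<close>.\<close>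

definition imf_form :: "real \<Rightarrow> real \<Rightarrow> real^'n::finite \<Rightarrow> real^'n^'n \<Rightarrow> real^'n^'n \<Rightarrow> real^'n^'n \<Rightarrow> real^'n \<Rightarrow> real" where
  "imf_form \<alpha> \<beta> w H1 H2 H3 k =
     (1 - \<alpha>) * (k \<bullet> (H1 *v k)) + \<alpha> * ((k - (w \<bullet> k) *\<^sub>R w) \<bullet> (H2 *v (k - (w \<bullet> k) *\<^sub>R w)))
     - \<beta> * ((w \<bullet> k)\<^sup>2 * (w \<bullet> (H3 *v w)))"

lemma imf_form_scaleR: "imf_form \<alpha> \<beta> w H1 H2 H3 (r *\<^sub>R k) = r\<^sup>2 * imf_form \<alpha> \<beta> w H1 H2 H3 k"
proof -
  have "r *\<^sub>R k - (w \<bullet> (r *\<^sub>R k)) *\<^sub>R w = r *\<^sub>R (k - (w \<bullet> k) *\<^sub>R w)"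
    by (simp add: scaleR_diff_right)
  then show ?thesis
    unfolding imf_form_def
    by (simp add: matrix_vector_mult_scaleR power2_eq_square algebra_simps del: scaleR_diff_right)
qed

text \<open>The line of \<open>w\<close> and its complement are both invariant under
  \<open>A\<close>, so the form splits: on the complement the two terms with \<alpha> cancel and
  leave the form of \<open>A\<close>, and on the line the factor is
  \<open>(1 - \<alpha> - \<beta>) * l\<close>.\<close>

lemma imf_form_saddle:
  fixes A :: "real^'n^'n"
  assumes A: "transpose A = A" and w: "norm w = 1" and Aw: "A *v w = l *\<^sub>R w"
    and m: "\<And>k. w \<bullet> k = 0 \<Longrightarrow> m * (norm k)\<^sup>2 \<le> k \<bullet> (A *v k)"
  shows "min m ((1 - \<alpha> - \<beta>) * l) * (norm k)\<^sup>2 \<le> imf_form \<alpha> \<beta> w A A A k"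
proof -
  define s q where "s = w \<bullet> k" and "q = k - s *\<^sub>R w"
  have ww: "w \<bullet> w = 1" using w by (simp add: dot_square_norm)
  have wq: "w \<bullet> q = 0" by (simp add: q_def inner_diff_right ww s_def)
  then have qw: "q \<bullet> w = 0" by (simp add: inner_commute)
  have k: "k = s *\<^sub>R w + q" by (simp add: q_def)
  have wAq: "w \<bullet> (A *v q) = 0" by (rule orthogonal_eigenvector_invariant[OF A Aw wq])
  have kAk: "k \<bullet> (A *v k) = s\<^sup>2 * l + q \<bullet> (A *v q)"
    unfolding k matrix_vector_right_distrib matrix_vector_mult_scaleR inner_add_left inner_add_right
      inner_scaleR_left inner_scaleR_right Aw wAq qw ww by (simp add: power2_eq_square)
  have nk: "(norm k)\<^sup>2 = s\<^sup>2 + (norm q)\<^sup>2"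
    unfolding power2_norm_eq_inner k inner_add_left inner_add_right
      inner_scaleR_left inner_scaleR_right wq qw ww by (simp add: power2_eq_square)
  have wAw: "w \<bullet> (A *v w) = l" using Aw ww by simp
  have "imf_form \<alpha> \<beta> w A A A k = q \<bullet> (A *v q) + ((1 - \<alpha> - \<beta>) * l) * s\<^sup>2"
    unfolding imf_form_def s_def[symmetric] q_def[symmetric] kAk wAw by (simp add: algebra_simps)
  moreover have "min m ((1 - \<alpha> - \<beta>) * l) * (norm q)\<^sup>2 \<le> q \<bullet> (A *v q)"
    by (rule order_trans[OF mult_right_mono m[OF wq]]) auto
  moreover have "min m ((1 - \<alpha> - \<beta>) * l) * s\<^sup>2 \<le> ((1 - \<alpha> - \<beta>) * l) * s\<^sup>2"
    by (rule mult_right_mono) auto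
  ultimately show ?thesis unfolding nk by (simp add: distrib_left)
qed

text \<open>Compactness of the unit sphere makes the continuity of the form uniform in
  \<open>k\<close>: near \<open>(w, A, A, A)\<close> it changes by at most \<open>c\<close> there,
  which costs one half of \<open>2 * c\<close>. Homogeneity extends the bound to all
  \<open>k\<close>.\<close>

lemma imf_form_coercive:
  fixes A :: "real^'n^'n"
  assumes c: "c > 0" and lb: "\<And>k. 2 * c * (norm k)\<^sup>2 \<le> imf_form \<alpha> \<beta> w A A A k"
  shows "\<forall>\<^sub>F (w, H1, H2, H3) in nhds (w, A, A, A). \<forall>k. c * (norm k)\<^sup>2 \<le> imf_form \<alpha> \<beta> w H1 H2 H3 k"
proof -
  define F where "F = (\<lambda>((w :: real^'n, H1, H2, H3), k). imf_form \<alpha> \<beta> w H1 H2 H3 k)"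
  have "continuous_on (UNIV \<times> sphere 0 1) F"
    unfolding F_def imf_form_def case_prod_unfold
    by (intro continuous_intros bounded_bilinear.continuous_on[OF bounded_bilinear_matrix_vector_mult])
  from continuous_on_prod_compactE[where ?x0.0 = "(w, A, A, A)", OF this compact_sphere UNIV_I c]
  obtain X0 where X0: "(w, A, A, A) \<in> X0" "open X0"
    "\<forall>p\<in>X0 \<inter> UNIV. \<forall>k\<in>sphere 0 1. dist (F (p, k)) (F ((w, A, A, A), k)) \<le> c"
    by blast
  have "c * (norm k)\<^sup>2 \<le> imf_form \<alpha> \<beta> w' H1 H2 H3 k" if "(w', H1, H2, H3) \<in> X0" for w' H1 H2 H3 k
  proof (cases "k = 0")
    case False
    define u where "u = (1 / norm k) *\<^sub>R k"
    have u: "norm u = 1" "k = norm k *\<^sub>R u" using False by (simp_all add: u_def)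
    have "dist (imf_form \<alpha> \<beta> w' H1 H2 H3 u) (imf_form \<alpha> \<beta> w A A A u) \<le> c"
      using X0(3) that u(1) by (force simp: F_def)
    then have "c \<le> imf_form \<alpha> \<beta> w' H1 H2 H3 u" using lb[of u] u(1) by (simp add: dist_real_def)
    then have "(norm k)\<^sup>2 * c \<le> (norm k)\<^sup>2 * imf_form \<alpha> \<beta> w' H1 H2 H3 u"
      by (intro mult_left_mono) auto
    also have "\<dots> = imf_form \<alpha> \<beta> w' H1 H2 H3 k"
      by (subst (2) u(2)) (simp only: imf_form_scaleR)
    finally show ?thesis by (simp add: mult.commute)
  qed (simp add: imf_form_def)
  then show ?thesis using X0(1,2) unfolding eventually_nhds by (auto intro!: exI[of _ X0])
qed

text \<open>Carries simplicity of the smallest eigenvalue from the saddle point to nearby Hessians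
  \<open>B\<close>. The vector \<open>e\<close> is the unstable direction at the saddle; the sign
  conditions on it survive small perturbations and leave room for only one negative
  direction.\<close>

lemma simple_eigenvalue_nearby:
  fixes A B :: "real^'n^'n"
  assumes B: "transpose B = B" and w: "is_arg_min (\<lambda>u. u \<bullet> (B *v u)) (\<lambda>u. norm u = 1) w"
    and neg: "e \<bullet> (B *v e) < 0" and ne: "norm e = 1"
    and pos: "\<And>k. e \<bullet> k = 0 \<Longrightarrow> k \<noteq> 0 \<Longrightarrow> 0 < k \<bullet> (B *v k)"
    and k: "w \<bullet> k = 0" "B *v k = (w \<bullet> (B *v w)) *\<^sub>R k"
  shows "k = 0"
proof -
  note a = arg_min_sphere_eigenvector[OF B w]
  define l where "l = w \<bullet> (B *v w)"
  have "l < 0" using a(3)[of e] neg ne by (simp add: l_def)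
  then have l: "x = 0" if "e \<bullet> x = 0" "B *v x = l *\<^sub>R x" for x
  proof -
    have "x \<bullet> (B *v x) \<le> 0" using that(2) \<open>l < 0\<close> by (simp add: mult_nonpos_nonneg)
    then show ?thesis using pos[OF that(1)] by force
  qed
  have Bw: "B *v w = l *\<^sub>R w" unfolding l_def by (rule a(2))
  have Bk: "B *v k = l *\<^sub>R k" unfolding l_def by (rule k(2))
  \<comment> \<open>Otherwise the plane spanned by \<open>w\<close> and \<open>k\<close>, on which the form is negative, would meet
    the hyperplane orthogonal to \<open>e\<close>.\<close>
  define z where "z = (e \<bullet> w) *\<^sub>R k - (e \<bullet> k) *\<^sub>R w"
  have "z = 0"
  proof (rule l)
    show "e \<bullet> z = 0" by (simp add: z_def inner_diff_right)
    show "B *v z = l *\<^sub>R z"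
      by (simp add: z_def matrix_vector_mult_diff_distrib matrix_vector_mult_scaleR Bk Bw algebra_simps)
  qed
  then have "z \<bullet> k = 0" by simp
  then have "(e \<bullet> w) * (k \<bullet> k) = 0" using k(1) by (simp add: z_def inner_diff_left)
  moreover have "e \<bullet> w \<noteq> 0"
  proof
    assume "e \<bullet> w = 0"
    then have "w = 0" using Bw by (rule l)
    then show False using a(1) by simp
  qed
  ultimately show ?thesis by simp
qed

text \<open>The inner maps \<open>y - P (y - x)\<close> and \<open>x + P (y - x)\<close> have the
  symmetric derivatives \<open>1 - P\<close> and \<open>P\<close>, which the chain rule applies to
  the gradients. Only \<open>outer_square w\<close> enters, so \<open>v\<close> may be exchanged for
  any choice with the same outer square.\<close>

definition imf_gradient ::
  "(real^'n::finite \<Rightarrow> real) \<Rightarrow> real^'n \<Rightarrow> real \<Rightarrow> real \<Rightarrow> real^'n \<Rightarrow> real^'n \<Rightarrow> real^'n" where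
  "imf_gradient V w \<alpha> \<beta> x y =
     (let P = (*v) (outer_square w); ga = gradient V (y - P (y - x)); gb = gradient V (x + P (y - x))
      in (1 - \<alpha>) *\<^sub>R gradient V y + \<alpha> *\<^sub>R (ga - P ga) - \<beta> *\<^sub>R P gb)"

definition imf_hessian ::
  "(real^'n::finite \<Rightarrow> real) \<Rightarrow> real^'n \<Rightarrow> real \<Rightarrow> real \<Rightarrow> real^'n \<Rightarrow> real^'n \<Rightarrow> real^'n \<Rightarrow> real^'n" where
  "imf_hessian V w \<alpha> \<beta> x y k =
     (let P = (*v) (outer_square w); z = hessian V (y - P (y - x)) *v (k - P k)
      in (1 - \<alpha>) *\<^sub>R (hessian V y *v k) + \<alpha> *\<^sub>R (z - P z) - \<beta> *\<^sub>R P (hessian V (x + P (y - x)) *v P k))"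

lemma imf_objective_has_derivative:
  fixes V :: "real^'n::finite \<Rightarrow> real"
  assumes V: "\<And>z. V differentiable at z"
  shows "(imf_objective V w \<alpha> \<beta> x has_derivative (\<lambda>h. imf_gradient V w \<alpha> \<beta> x y \<bullet> h)) (at y)"
proof -
  let ?a = "\<lambda>y. y - outer_square w *v (y - x)" and ?b = "\<lambda>y. x + outer_square w *v (y - x)"
  note P = bounded_linear.has_derivative[OF matrix_vector_mul_bounded_linear[of "outer_square w"]]
  note g = has_derivative_gradient[OF V]
  have P0: "((\<lambda>y. outer_square w *v (y - x)) has_derivative (\<lambda>h. outer_square w *v h)) (at y)"
    by (rule P) (auto intro!: derivative_eq_intros)
  have a: "((\<lambda>y. V (?a y)) has_derivative (\<lambda>h. gradient V (?a y) \<bullet> (h - outer_square w *v h))) (at y)"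
    by (rule has_derivative_compose[where f = ?a, OF _ g]) (auto intro!: derivative_eq_intros P0)
  have b: "((\<lambda>y. V (?b y)) has_derivative (\<lambda>h. gradient V (?b y) \<bullet> (outer_square w *v h))) (at y)"
    by (rule has_derivative_compose[where f = ?b, OF _ g]) (auto intro!: derivative_eq_intros P0)
  have "((\<lambda>y. (1 - \<alpha>) * V y + \<alpha> * V (?a y) - \<beta> * V (?b y)) has_derivative
     (\<lambda>h. (1 - \<alpha>) * (gradient V y \<bullet> h) + \<alpha> * (gradient V (?a y) \<bullet> (h - outer_square w *v h))
      - \<beta> * (gradient V (?b y) \<bullet> (outer_square w *v h)))) (at y)"
    by (intro has_derivative_add has_derivative_diff has_derivative_mult_right g a b)
  then show ?thesis
    unfolding imf_objective_def imf_gradient_def Let_def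
    by (rule has_derivative_eq_rhs)
      (simp add: fun_eq_iff outer_square_mult inner_add_left inner_add_right inner_diff_left
        inner_diff_right inner_commute)
qed

lemma imf_gradient_has_derivative:
  fixes V :: "real^'n::finite \<Rightarrow> real"
  assumes V: "continuously_differentiable (Suc (Suc k)) V"
  shows "(imf_gradient V w \<alpha> \<beta> x has_derivative imf_hessian V w \<alpha> \<beta> x y) (at y)"
proof -
  let ?a = "\<lambda>y. y - outer_square w *v (y - x)" and ?b = "\<lambda>y. x + outer_square w *v (y - x)"
  note P = bounded_linear.has_derivative[OF matrix_vector_mul_bounded_linear[of "outer_square w"]]
  note g = has_derivative_hessian[OF V]
  have P0: "((\<lambda>y. outer_square w *v (y - x)) has_derivative (\<lambda>h. outer_square w *v h)) (at y)"
    by (rule P) (auto intro!: derivative_eq_intros)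
  have a: "((\<lambda>y. gradient V (?a y)) has_derivative (\<lambda>h. hessian V (?a y) *v (h - outer_square w *v h))) (at y)"
    by (rule has_derivative_compose[where f = ?a, OF _ g]) (auto intro!: derivative_eq_intros P0)
  have b: "((\<lambda>y. gradient V (?b y)) has_derivative (\<lambda>h. hessian V (?b y) *v (outer_square w *v h))) (at y)"
    by (rule has_derivative_compose[where f = ?b, OF _ g]) (auto intro!: derivative_eq_intros P0)
  show ?thesis
    unfolding imf_gradient_def imf_hessian_def Let_def
    by (intro has_derivative_add has_derivative_diff has_derivative_scaleR_right g a b P)
qed

lemma inner_imf_hessian:
  "k \<bullet> imf_hessian V w \<alpha> \<beta> x y k = imf_form \<alpha> \<beta> w (hessian V y)
     (hessian V (y - outer_square w *v (y - x))) (hessian V (x + outer_square w *v (y - x))) k"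
  unfolding imf_hessian_def imf_form_def Let_def
  by (simp add: outer_square_mult[of w k] outer_square_mult[of w "_ *v _"] inner_add_right inner_diff_right
      inner_diff_left matrix_vector_mult_scaleR power2_eq_square inner_commute[of k w])

lemma imf_gradient_cong: "outer_square w = outer_square w' \<Longrightarrow> imf_gradient V w \<alpha> \<beta> = imf_gradient V w' \<alpha> \<beta>"
  by (simp add: imf_gradient_def fun_eq_iff)

lemma imf_hessian_cong: "outer_square w = outer_square w' \<Longrightarrow> imf_hessian V w \<alpha> \<beta> = imf_hessian V w' \<alpha> \<beta>"
  by (simp add: imf_hessian_def fun_eq_iff)

text \<open>The map \<open>1 - (\<alpha> + \<beta>) P\<close> is injective: it is the identity on
  the complement of \<open>w\<close> and multiplies \<open>w\<close> by a nonzero factor. Pairing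
  with \<open>w\<close> isolates that factor.\<close>

lemma imf_gradient_diagonal_eq_0_iff:
  assumes w: "norm w = 1" and ab: "\<alpha> + \<beta> \<noteq> 1"
  shows "imf_gradient V w \<alpha> \<beta> x x = 0 \<longleftrightarrow> gradient V x = 0"
proof
  define g where "g = gradient V x"
  have ww: "w \<bullet> w = 1" using w by (simp add: dot_square_norm)
  assume "imf_gradient V w \<alpha> \<beta> x x = 0"
  then have 0: "(1 - \<alpha>) *\<^sub>R g + \<alpha> *\<^sub>R (g - (w \<bullet> g) *\<^sub>R w) - \<beta> *\<^sub>R (w \<bullet> g) *\<^sub>R w = 0"
    by (simp add: imf_gradient_def Let_def outer_square_mult g_def)
  then have "w \<bullet> ((1 - \<alpha>) *\<^sub>R g + \<alpha> *\<^sub>R (g - (w \<bullet> g) *\<^sub>R w) - \<beta> *\<^sub>R (w \<bullet> g) *\<^sub>R w) = 0" by simp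
  then have "(1 - (\<alpha> + \<beta>)) * (w \<bullet> g) = 0"
    by (simp add: inner_add_right inner_diff_right ww algebra_simps)
  then have "w \<bullet> g = 0" using ab by simp
  with 0 show "gradient V x = 0" by (simp add: g_def flip: scaleR_add_left)
next
  assume "gradient V x = 0"
  then show "imf_gradient V w \<alpha> \<beta> x x = 0" by (simp add: imf_gradient_def)
qed

text \<open>Stated for a differentiable \<open>w\<close> because the given field \<open>v\<close>
  may jump in sign.\<close>

lemma imf_gradient_jointly_differentiable:
  fixes V :: "real^'n::finite \<Rightarrow> real"
  assumes V: "continuously_differentiable (Suc (Suc k)) V" and w: "w differentiable at x0"
  shows "(\<lambda>(y, x). imf_gradient V (w x) \<alpha> \<beta> x y) differentiable at (y0, x0)"
proof -
  let ?F = "at (y0, x0)"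
  have fst: "(\<lambda>p. fst p) differentiable ?F" and snd: "(\<lambda>p. snd p) differentiable ?F"
    by (auto intro: bounded_linear_imp_differentiable bounded_linear_fst bounded_linear_snd)
  have W: "(\<lambda>p. w (snd p)) differentiable ?F"
    using differentiable_chain_at[of snd "(y0, x0)" w] snd w by (simp add: o_def)
  have g: "(\<lambda>p. gradient V (f p)) differentiable ?F" if "f differentiable ?F" for f
    using differentiable_chain_at[OF that gradient_differentiable[OF V]] by (simp add: o_def)
  have "(\<lambda>p. imf_gradient V (w (snd p)) \<alpha> \<beta> (snd p) (fst p)) differentiable ?F"
    unfolding imf_gradient_def Let_def outer_square_mult
    by (intro differentiable_add differentiable_diff differentiable_scaleR differentiable_const
        differentiable_inner g W fst snd)
  then show ?thesis by (simp add: case_prod_unfold)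
qed

text \<open>The derivative of \<open>w\<close> drops out everywhere, being multiplied by
  \<open>xs - x\<close> or by the gradient of \<open>V\<close>, both zero at \<open>x = xs\<close>.
  With \<open>H\<close> the Hessian at \<open>xs\<close>, what remains is
  \<open>\<alpha> (1 - P) H P - \<beta> P H (1 - P)\<close>, and this vanishes since
  \<open>P\<close> commutes with \<open>H\<close>.\<close>

lemma imf_gradient_saddle_has_derivative:
  fixes V :: "real^'n::finite \<Rightarrow> real"
  assumes V: "continuously_differentiable (Suc (Suc k)) V" and sym: "transpose (hessian V xs) = hessian V xs"
    and 0: "gradient V xs = 0"
    and w: "w differentiable at xs" "norm (w xs) = 1" "hessian V xs *v w xs = l *\<^sub>R w xs"
  shows "((\<lambda>x. imf_gradient V (w x) \<alpha> \<beta> x xs) has_derivative (\<lambda>h. 0)) (at xs)"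
proof -
  define w0 where "w0 = w xs"
  obtain w' where w': "(w has_derivative w') (at xs)" using w(1) by (auto simp: differentiable_def)
  have w'0: "w' 0 = 0" using w' has_derivative_linear linear_0 by blast
  have ww: "w0 \<bullet> w0 = 1" using w(2) by (simp add: w0_def dot_square_norm)
  note g = has_derivative_hessian[OF V]
  let ?a = "\<lambda>x. xs - (w x \<bullet> (xs - x)) *\<^sub>R w x" and ?b = "\<lambda>x. x + (w x \<bullet> (xs - x)) *\<^sub>R w x"
  have a: "(?a has_derivative (\<lambda>h. (w0 \<bullet> h) *\<^sub>R w0)) (at xs)"
    by (auto intro!: derivative_eq_intros w' simp: w0_def)
  have b: "(?b has_derivative (\<lambda>h. h - (w0 \<bullet> h) *\<^sub>R w0)) (at xs)"
    by (auto intro!: derivative_eq_intros w' simp: w0_def)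
  have ga: "((\<lambda>x. gradient V (?a x)) has_derivative (\<lambda>h. hessian V xs *v ((w0 \<bullet> h) *\<^sub>R w0))) (at xs)"
    using has_derivative_compose[OF a g] by simp
  have gb: "((\<lambda>x. gradient V (?b x)) has_derivative (\<lambda>h. hessian V xs *v (h - (w0 \<bullet> h) *\<^sub>R w0))) (at xs)"
    using has_derivative_compose[OF b g] by simp
  have Hw: "hessian V xs *v w0 = l *\<^sub>R w0" using w(3) by (simp add: w0_def)
  have "w0 \<bullet> (hessian V xs *v h) = (hessian V xs *v w0) \<bullet> h" for h
    by (rule symmetric_matrix_inner[OF sym])
  then have wH: "w0 \<bullet> (hessian V xs *v h) = l * (w0 \<bullet> h)" for h by (simp add: Hw)
  have "((\<lambda>x. (w x \<bullet> gradient V (?a x)) *\<^sub>R w x) has_derivative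
      (\<lambda>h. (w0 \<bullet> (hessian V xs *v ((w0 \<bullet> h) *\<^sub>R w0))) *\<^sub>R w0)) (at xs)"
    by (rule derivative_eq_intros w' ga refl)+ (simp add: 0 w0_def)
  note Pa = this
  have Pb: "((\<lambda>x. (w x \<bullet> gradient V (?b x)) *\<^sub>R w x) has_derivative
      (\<lambda>h. (w0 \<bullet> (hessian V xs *v (h - (w0 \<bullet> h) *\<^sub>R w0))) *\<^sub>R w0)) (at xs)"
    by (rule derivative_eq_intros w' gb refl)+ (simp add: 0 w0_def)
  have "((\<lambda>x. (1 - \<alpha>) *\<^sub>R gradient V xs
      + \<alpha> *\<^sub>R (gradient V (?a x) - (w x \<bullet> gradient V (?a x)) *\<^sub>R w x)
      - \<beta> *\<^sub>R ((w x \<bullet> gradient V (?b x)) *\<^sub>R w x)) has_derivative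
     (\<lambda>h. 0 + \<alpha> *\<^sub>R (hessian V xs *v ((w0 \<bullet> h) *\<^sub>R w0) - (w0 \<bullet> (hessian V xs *v ((w0 \<bullet> h) *\<^sub>R w0))) *\<^sub>R w0)
      - \<beta> *\<^sub>R ((w0 \<bullet> (hessian V xs *v (h - (w0 \<bullet> h) *\<^sub>R w0))) *\<^sub>R w0))) (at xs)"
    by (intro has_derivative_add has_derivative_diff has_derivative_scaleR_right has_derivative_const ga Pa Pb)
  moreover have "0 + \<alpha> *\<^sub>R (hessian V xs *v ((w0 \<bullet> h) *\<^sub>R w0) - (w0 \<bullet> (hessian V xs *v ((w0 \<bullet> h) *\<^sub>R w0))) *\<^sub>R w0)
      - \<beta> *\<^sub>R ((w0 \<bullet> (hessian V xs *v (h - (w0 \<bullet> h) *\<^sub>R w0))) *\<^sub>R w0) = 0" for h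
    unfolding wH by (simp add: matrix_vector_mult_scaleR Hw inner_diff_right ww)
  ultimately show ?thesis by (simp add: imf_gradient_def Let_def outer_square_mult)
qed

lemma has_derivative_zero_dominated:
  fixes f :: "'a::real_normed_vector \<Rightarrow> 'b::real_normed_vector" and h :: "'a \<Rightarrow> 'c::real_normed_vector"
  assumes h: "(h has_derivative (\<lambda>_. 0)) (at x)" "h x = 0"
    and le: "\<forall>\<^sub>F y in nhds x. norm (f y - f x) \<le> C * norm (h y)" and C: "C > 0"
  shows "(f has_derivative (\<lambda>_. 0)) (at x)"
  unfolding has_derivative_at_alt
proof (intro conjI allI impI)
  fix e :: real assume "e > 0"
  then have "e / C > 0" using C by simp
  then obtain d where d: "d > 0" "\<And>y. norm (y - x) < d \<Longrightarrow> norm (h y) \<le> e / C * norm (y - x)"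
    using h unfolding has_derivative_at_alt by auto
  obtain d' where d': "d' > 0" "\<And>y. dist y x < d' \<Longrightarrow> norm (f y - f x) \<le> C * norm (h y)"
    using le unfolding eventually_nhds_metric by blast
  have "norm (f y - f x) \<le> e * norm (y - x)" if "norm (y - x) < min d d'" for y
  proof -
    have "norm (f y - f x) \<le> C * norm (h y)" using d'(2)[of y] that by (simp add: dist_norm)
    also have "\<dots> \<le> C * (e / C * norm (y - x))" using d(2)[of y] that C by (intro mult_left_mono) auto
    finally show ?thesis using C by simp
  qed
  then show "\<exists>d>0. \<forall>y. norm (y - x) < d \<longrightarrow> norm (f y - f x - 0) \<le> e * norm (y - x)"
    using d(1) d'(1) by (intro exI[of _ "min d d'"]) auto
qed simp

section \<open>Uniform estimates on a ball around the saddle point\<close>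

lemma isCont_tendsto_nhds: "isCont f x \<Longrightarrow> (f \<longlongrightarrow> f x) (nhds x)"
  by (simp add: isCont_def tendsto_at_iff_tendsto_nhds)

text \<open>Collects all local information on one ball. The factor \<open>c / 4\<close> is chosen so
  that a minimizer of the objective will lie at most half as far from \<open>xs\<close> as the
  parameter \<open>x\<close>.\<close>

lemma imf_saddle_neighborhood:
  fixes V :: "real^'n::finite \<Rightarrow> real" and v :: "real^'n \<Rightarrow> real^'n"
  assumes V: "continuously_differentiable (Suc (Suc (Suc k))) V"
    and v: "\<And>x. is_arg_min (\<lambda>u. u \<bullet> (hessian V x *v u)) (\<lambda>u. norm u = 1) (v x)"
    and ab: "\<alpha> + \<beta> > 1"
    and saddle: "index1_saddle V xs"
  obtains R c where "R > 0" "c > 0"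
    "\<And>x y k. x \<in> ball xs R \<Longrightarrow> y \<in> ball xs R \<Longrightarrow> c * (norm k)\<^sup>2 \<le> k \<bullet> imf_hessian V (v x) \<alpha> \<beta> x y k"
    "\<And>x. x \<in> ball xs R \<Longrightarrow> \<exists>w. w differentiable at x \<and> (\<forall>\<^sub>F z in nhds x. outer_square (w z) = outer_square (v z))"
    "\<And>x. x \<in> ball xs R \<Longrightarrow> norm (imf_gradient V (v x) \<alpha> \<beta> x xs) \<le> c / 4 * norm (x - xs)"
    "((\<lambda>x. imf_gradient V (v x) \<alpha> \<beta> x xs) has_derivative (\<lambda>h. 0)) (at xs)"
proof -
  note sym = hessian_symmetric[OF V]
  note nv = arg_min_sphere_eigenvector(1)[OF sym v]
  have grad0: "gradient V xs = 0" using saddle by (simp add: index1_saddle_def)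
  obtain l where l: "l < 0" "eigenvalue (hessian V xs) l" "dim (eigenspace (hessian V xs) l) = 1"
    "\<And>m. eigenvalue (hessian V xs) m \<Longrightarrow> m \<noteq> l \<Longrightarrow> m > 0"
    using saddle unfolding index1_saddle_def by blast
  note spec = index1_saddle_spectrum[OF sym v l]
  obtain m where m: "m > 0" "\<And>k. v xs \<bullet> k = 0 \<Longrightarrow> m * (norm k)\<^sup>2 \<le> k \<bullet> (hessian V xs *v k)"
    using spec(2) by blast
  have vHv: "v xs \<bullet> (hessian V xs *v v xs) = l"
    using spec(1) nv[of xs] by (simp add: dot_square_norm)
  obtain K where K: "K > 0"
    "\<And>(M::real^'n^'n) N k. \<bar>k \<bullet> (N *v k) - k \<bullet> (M *v k)\<bar> \<le> K * norm (N - M) * (norm k)\<^sup>2"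
    by (rule quadratic_form_perturbation) blast
  note form = K(2)[of _ "hessian V _" "hessian V xs"]
  have contH: "isCont (hessian V) x" for x
    using differentiable_imp_continuous_within[OF hessian_differentiable[OF V]] .
  have simple: "\<forall>\<^sub>F x in nhds xs. \<forall>k. v x \<bullet> k = 0 \<longrightarrow> hessian V x *v k = (v x \<bullet> (hessian V x *v v x)) *\<^sub>R k \<longrightarrow> k = 0"
  proof -
    have "((\<lambda>x. K * norm (hessian V x - hessian V xs)) \<longlongrightarrow> K * norm (hessian V xs - hessian V xs)) (nhds xs)"
      using contH[of xs] by (intro tendsto_intros) (auto simp: isCont_def tendsto_at_iff_tendsto_nhds)
    then have lim: "((\<lambda>x. K * norm (hessian V x - hessian V xs)) \<longlongrightarrow> 0) (nhds xs)" by simp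
    \<comment> \<open>A perturbation of the form below this threshold keeps it negative at
      \<open>v xs\<close>, where it was \<open>l\<close>, and positive on the complement, where it
      was at least \<open>m * (norm k)\<^sup>2\<close>.\<close>
    have "0 < min m (- l)" using m(1) l(1) by simp
    with lim have "\<forall>\<^sub>F x in nhds xs. K * norm (hessian V x - hessian V xs) < min m (- l)"
      by (rule order_tendstoD)
    then show ?thesis
    proof eventually_elim
      case (elim x)
      have neg: "v xs \<bullet> (hessian V x *v v xs) < 0"
      proof -
        have "\<bar>v xs \<bullet> (hessian V x *v v xs) - l\<bar> \<le> K * norm (hessian V x - hessian V xs)"
          using form[of "v xs" x] by (simp add: vHv nv)
        with elim show ?thesis by linarith
      qed
      have pos: "0 < k \<bullet> (hessian V x *v k)" if "v xs \<bullet> k = 0" "k \<noteq> 0" for k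
      proof -
        have "K * norm (hessian V x - hessian V xs) * (norm k)\<^sup>2 < m * (norm k)\<^sup>2"
          using elim that(2) by (intro mult_strict_right_mono) auto
        then show ?thesis using form[of k x] m(2)[OF that(1)] by linarith
      qed
      show ?case using simple_eigenvalue_nearby[OF sym v neg nv pos] by blast
    qed
  qed
  have simple_at: "\<exists>w. w differentiable at x \<and> w x = v x \<and>
      (\<forall>\<^sub>F z in nhds x. norm (w z) = 1 \<and> outer_square (w z) = outer_square (v z))"
    if x: "\<forall>k. v x \<bullet> k = 0 \<longrightarrow> hessian V x *v k = (v x \<bullet> (hessian V x *v v x)) *\<^sub>R k \<longrightarrow> k = 0" for x
  proof (rule minimal_eigenvector_differentiable[OF sym v hessian_differentiable[OF V], of x])
    fix k assume "v x \<bullet> k = 0" "hessian V x *v k = (v x \<bullet> (hessian V x *v v x)) *\<^sub>R k"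
    with x show "k = 0" by blast
  qed blast
  obtain w where w: "w differentiable at xs" "w xs = v xs"
    "\<forall>\<^sub>F z in nhds xs. norm (w z) = 1 \<and> outer_square (w z) = outer_square (v z)"
    using simple_at[OF eventually_nhds_x_imp_x[OF simple]] by blast
  \<comment> \<open>Half of the coercivity constant at the saddle; the other half absorbs the
    variation over the neighborhood. Both entries of the minimum are positive because
    \<open>l < 0\<close> and \<open>\<alpha> + \<beta> > 1\<close>.\<close>
  define c where "c = min m ((1 - \<alpha> - \<beta>) * l) / 2"
  have "(1 - \<alpha> - \<beta>) * l > 0" using ab l(1) by (intro mult_neg_neg) auto
  then have c: "c > 0" using m(1) by (simp add: c_def)
  have "2 * c * (norm k)\<^sup>2 \<le> imf_form \<alpha> \<beta> (w xs) (hessian V xs) (hessian V xs) (hessian V xs) k" for k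
    using imf_form_saddle[OF sym nv spec(1) m(2)] by (simp add: c_def w(2))
  note ev = imf_form_coercive[OF c this]
  \<comment> \<open>Pairs are ordered as \<open>p = (y, x)\<close>. At \<open>(xs, xs)\<close> the
    displacement \<open>?P\<close> is zero, so all three Hessians in \<open>?T\<close> agree
    there.\<close>
  let ?P = "\<lambda>p. (w (snd p) \<bullet> (fst p - snd p)) *\<^sub>R w (snd p)"
  let ?T = "\<lambda>p. (w (snd p), hessian V (fst p), hessian V (fst p - ?P p), hessian V (snd p + ?P p))"
  have fs: "isCont fst p" "isCont snd p" for p :: "(real^'n) \<times> (real^'n)"
    by (auto intro: continuous_intros)
  have contw: "isCont (\<lambda>p. w (snd p)) (xs, xs)"
    using isCont_o2[where f = snd and g = w, OF fs(2), of "(xs, xs)"] differentiable_imp_continuous_within[OF w(1)]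
    by simp
  have contP: "isCont ?P (xs, xs)"
    by (intro continuous_intros contw fs)
  have "isCont ?T (xs, xs)"
    by (intro continuous_Pair contw isCont_o2[where g = "hessian V", OF _ contH] continuous_diff continuous_add contP fs)
  from isCont_tendsto_nhds[OF this] have limT: "filterlim ?T (nhds (w xs, hessian V xs, hessian V xs, hessian V xs)) (nhds (xs, xs))"
    by simp
  have "\<forall>\<^sub>F p in nhds xs \<times>\<^sub>F nhds xs. case ?T p of (w, H1, H2, H3) \<Rightarrow> \<forall>k. c * (norm k)\<^sup>2 \<le> imf_form \<alpha> \<beta> w H1 H2 H3 k"
    using eventually_compose_filterlim[OF ev limT] unfolding nhds_prod .
  then obtain Py Px where P: "eventually Py (nhds xs)" "eventually Px (nhds xs)"
    "\<And>y x. Py y \<Longrightarrow> Px x \<Longrightarrow> case ?T (y, x) of (w, H1, H2, H3) \<Rightarrow> \<forall>k. c * (norm k)\<^sup>2 \<le> imf_form \<alpha> \<beta> w H1 H2 H3 k"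
    unfolding eventually_prod_filter by blast
  have der_w: "((\<lambda>x. imf_gradient V (w x) \<alpha> \<beta> x xs) has_derivative (\<lambda>h. 0)) (at xs)"
    using w nv spec(1) by (intro imf_gradient_saddle_has_derivative[OF V sym grad0]) auto
  have eq: "\<forall>\<^sub>F x in nhds xs. imf_gradient V (w x) \<alpha> \<beta> x xs = imf_gradient V (v x) \<alpha> \<beta> x xs"
    using w(3) by eventually_elim (metis imf_gradient_cong)
  have der: "((\<lambda>x. imf_gradient V (v x) \<alpha> \<beta> x xs) has_derivative (\<lambda>h. 0)) (at xs)"
    using der_w eq eventually_nhds_x_imp_x[OF eq]
    by (intro has_derivative_transform_eventually[OF der_w]) (auto simp: eventually_nhds_conv_at)
  have "imf_gradient V (v xs) \<alpha> \<beta> xs xs = 0"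
    using imf_gradient_diagonal_eq_0_iff[OF nv] ab grad0 by simp
  moreover have "c / 4 > 0" using c by simp
  ultimately obtain d where "d > 0"
    "\<And>x. norm (x - xs) < d \<Longrightarrow> norm (imf_gradient V (v x) \<alpha> \<beta> x xs) \<le> c / 4 * norm (x - xs)"
    using der unfolding has_derivative_at_alt by (metis diff_zero)
  then have small: "\<forall>\<^sub>F x in nhds xs. norm (imf_gradient V (v x) \<alpha> \<beta> x xs) \<le> c / 4 * norm (x - xs)"
    unfolding eventually_nhds_metric by (auto simp: dist_norm)
  have "\<forall>\<^sub>F x in nhds xs. Py x \<and> Px x \<and> outer_square (w x) = outer_square (v x) \<and>
      norm (imf_gradient V (v x) \<alpha> \<beta> x xs) \<le> c / 4 * norm (x - xs) \<and>
      (\<forall>k. v x \<bullet> k = 0 \<longrightarrow> hessian V x *v k = (v x \<bullet> (hessian V x *v v x)) *\<^sub>R k \<longrightarrow> k = 0)"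
    using P(1,2) w(3) small simple by eventually_elim blast
  then obtain R where R: "R > 0" "\<And>x. dist x xs < R \<Longrightarrow> Py x \<and> Px x \<and> outer_square (w x) = outer_square (v x) \<and>
      norm (imf_gradient V (v x) \<alpha> \<beta> x xs) \<le> c / 4 * norm (x - xs) \<and>
      (\<forall>k. v x \<bullet> k = 0 \<longrightarrow> hessian V x *v k = (v x \<bullet> (hessian V x *v v x)) *\<^sub>R k \<longrightarrow> k = 0)"
    unfolding eventually_nhds_metric by blast
  show ?thesis
  proof (rule that[OF R(1) c _ _ _ der])
    fix x y k assume "x \<in> ball xs R" "y \<in> ball xs R"
    then have x: "Px x" "outer_square (w x) = outer_square (v x)" and y: "Py y"
      using R(2)[of x] R(2)[of y] by (auto simp: dist_commute)
    have "c * (norm k)\<^sup>2 \<le> k \<bullet> imf_hessian V (w x) \<alpha> \<beta> x y k"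
      using P(3)[OF y x(1)] by (simp add: inner_imf_hessian outer_square_mult)
    then show "c * (norm k)\<^sup>2 \<le> k \<bullet> imf_hessian V (v x) \<alpha> \<beta> x y k"
      using imf_hessian_cong[OF x(2), of V \<alpha> \<beta>] by simp
  next
    fix x assume x: "x \<in> ball xs R"
    show "\<exists>w. w differentiable at x \<and> (\<forall>\<^sub>F z in nhds x. outer_square (w z) = outer_square (v z))"
      using simple_at[of x] R(2)[of x] x by (force simp: dist_commute elim: eventually_mono)
    show "norm (imf_gradient V (v x) \<alpha> \<beta> x xs) \<le> c / 4 * norm (x - xs)"
      using R(2)[of x] x by (simp add: dist_commute)
  qed
qed

section \<open>Minimization over a ball and the properties of \<Phi>\<close>

theorem theorem1:
  fixes V :: "real^'n::finite \<Rightarrow> real"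
    and v :: "real^'n \<Rightarrow> real^'n"
    and \<alpha> \<beta> :: real
    and xs :: "real^'n"
  assumes "continuously_differentiable 3 V"
    and "\<And>x. is_arg_min (\<lambda>u. u \<bullet> (hessian V x *v u)) (\<lambda>u. norm u = 1) (v x)"
    and "\<alpha> + \<beta> > 1"
    and "index1_saddle V xs"
  shows "local_minimizer (imf_objective V (v xs) \<alpha> \<beta> xs) xs \<and>
    (\<exists>U. open U \<and> convex U \<and> xs \<in> U \<and>
      (\<forall>x\<in>U. strictly_convex_on U (imf_objective V (v x) \<alpha> \<beta> x) \<and>
              (\<exists>!y. is_arg_min (imf_objective V (v x) \<alpha> \<beta> x) (\<lambda>y. y \<in> U) y)) \<and>
      (\<forall>x\<in>U. \<exists>!y. y \<in> U \<and> local_minimizer (imf_objective V (v x) \<alpha> \<beta> x) y) \<and>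
      ((\<forall>x\<in>U. gradient V x = 0 \<longrightarrow> x = xs) \<longrightarrow>
         {x \<in> U. imf_map V v \<alpha> \<beta> U x = x} = {xs}) \<and>
      imf_map V v \<alpha> \<beta> U differentiable_on U \<and>
      jacobian (imf_map V v \<alpha> \<beta> U) (at xs) = 0)"
proof -
  have V: "continuously_differentiable (Suc (Suc (Suc 0))) V"
    using assms(1) by (simp only: numeral_3_eq_3)
  note v = assms(2) and ab = assms(3) and saddle = assms(4)
  note nv = arg_min_sphere_eigenvector(1)[OF hessian_symmetric[OF V] v]
  define f G where "f = (\<lambda>x. imf_objective V (v x) \<alpha> \<beta> x)" and "G = (\<lambda>x. imf_gradient V (v x) \<alpha> \<beta> x)"
  have f_deriv: "(f x has_derivative (\<lambda>h. G x y \<bullet> h)) (at y)" for x y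
    unfolding f_def G_def
    by (rule imf_objective_has_derivative[OF continuously_differentiable_differentiable[OF V]])
  have G_deriv: "(G x has_derivative imf_hessian V (v x) \<alpha> \<beta> x y) (at y)" for x y
    unfolding G_def by (rule imf_gradient_has_derivative[OF V])
  obtain R c where R: "R > 0" and c: "c > 0"
    and coercive: "\<And>x y k. x \<in> ball xs R \<Longrightarrow> y \<in> ball xs R \<Longrightarrow> c * (norm k)\<^sup>2 \<le> k \<bullet> imf_hessian V (v x) \<alpha> \<beta> x y k"
    and local: "\<And>x. x \<in> ball xs R \<Longrightarrow> \<exists>w. w differentiable at x \<and> (\<forall>\<^sub>F z in nhds x. outer_square (w z) = outer_square (v z))"
    and small: "\<And>x. x \<in> ball xs R \<Longrightarrow> norm (G x xs) \<le> c / 4 * norm (x - xs)"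
    and G_der: "((\<lambda>x. G x xs) has_derivative (\<lambda>h. 0)) (at xs)"
    using imf_saddle_neighborhood[OF V v ab saddle] unfolding G_def by blast
  have lb: "f x y1 + G x y1 \<bullet> (y2 - y1) + c / 2 * (norm (y2 - y1))\<^sup>2 \<le> f x y2"
    if "x \<in> ball xs R" "y1 \<in> ball xs R" "y2 \<in> ball xs R" for x y1 y2
    by (rule strong_convexity_lower_bound[OF convex_ball f_deriv G_deriv coercive that(2,3)])
      (use that(1) in auto)
  \<comment> \<open>Adding \<open>lb\<close> in both directions gives strong monotonicity of
    \<open>G x\<close>, so the gradient at \<open>y2\<close> controls the distance to the zero
    \<open>y1\<close>. Uniqueness of the zero, continuity of \<Phi> and its flatness at
    \<open>xs\<close> all rest on this.\<close>
  have mono: "c * norm (y2 - y1) \<le> norm (G x y2)"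
    if x: "x \<in> ball xs R" and y: "y1 \<in> ball xs R" "y2 \<in> ball xs R" and z: "G x y1 = 0" for x y1 y2
  proof (cases "y2 = y1")
    case False
    have "c * (norm (y2 - y1))\<^sup>2 \<le> G x y2 \<bullet> (y2 - y1)"
      using lb[OF x y] lb[OF x y(2,1)] z by (simp add: inner_diff_right norm_minus_commute)
    also have "\<dots> \<le> norm (G x y2) * norm (y2 - y1)" by (rule norm_cauchy_schwarz)
    finally show ?thesis using False by (simp add: power2_eq_square)
  qed simp
  \<comment> \<open>Half the radius, so that the compact closure of \<open>U\<close> still lies in
    the ball where the estimates hold.\<close>
  define U where "U = ball xs (R / 2)"
  have U: "open U" "convex U" "xs \<in> U" using R by (auto simp: U_def)
  have UR: "x \<in> ball xs R" if "x \<in> U" for x using that R by (simp add: U_def)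
  have critical: "G x y = 0" if "open S" "y \<in> S" "\<And>z. z \<in> S \<Longrightarrow> f x y \<le> f x z" for x y S
  proof -
    have "(\<lambda>h. G x y \<bullet> h) = (\<lambda>h. 0)"
      using differential_zero_maxmin[OF that(2,1) f_deriv] that(3) by blast
    then have "G x y \<bullet> G x y = 0" by meson
    then show ?thesis by simp
  qed
  have ex: "\<exists>y\<in>U. G x y = 0" if x: "x \<in> U" for x
  proof -
    have cont: "continuous_on (cball xs (R / 2)) (f x)"
      using f_deriv by (intro continuous_at_imp_continuous_on) (blast intro: has_derivative_continuous)
    have "cball xs (R / 2) \<noteq> {}" using R by simp
    from continuous_attains_inf[OF compact_cball this cont]
    obtain y where y: "y \<in> cball xs (R / 2)" "\<And>z. z \<in> cball xs (R / 2) \<Longrightarrow> f x y \<le> f x z" by blast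
    have yR: "y \<in> ball xs R" using y(1) R by simp
    define d where "d = y - xs"
    \<comment> \<open>Comparison with the center: strong convexity bounds
      \<open>c / 2 * (norm d)\<^sup>2\<close> by \<open>c / 4 * norm (x - xs) * norm d\<close>.
      Hence the minimizer over the closed ball is interior and the gradient vanishes there.\<close>
    have "f x y \<le> f x xs" using y(2) R by simp
    with lb[OF UR[OF x] UR[OF U(3)] yR] have "c / 2 * (norm d)\<^sup>2 \<le> - (G x xs \<bullet> d)" by (simp add: d_def)
    also have "\<dots> \<le> norm (G x xs) * norm d"
      using norm_cauchy_schwarz[of "G x xs" "- d"] by simp
    also have "\<dots> \<le> c / 4 * norm (x - xs) * norm d"
      using small[OF UR[OF x]] by (intro mult_right_mono) auto
    finally have "norm d \<le> norm (x - xs) / 2 \<or> norm d = 0"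
      using c by (auto simp: power2_eq_square field_simps)
    then have "norm d < R / 2" using x R by (auto simp: U_def dist_norm norm_minus_commute)
    then have "y \<in> U" by (simp add: U_def d_def dist_norm norm_minus_commute)
    moreover have "G x y = 0"
      by (rule critical[OF U(1) \<open>y \<in> U\<close>]) (rule y(2), simp add: U_def)
    ultimately show ?thesis by blast
  qed
  define ph where "ph = (\<lambda>x. SOME y. y \<in> U \<and> G x y = 0)"
  have ph: "ph x \<in> U" "G x (ph x) = 0" if "x \<in> U" for x
    using someI_ex[of "\<lambda>y. y \<in> U \<and> G x y = 0"] ex[OF that] by (auto simp: ph_def)
  have uniq: "y = ph x" if "x \<in> U" "y \<in> U" "G x y = 0" for x y
    using mono[OF UR[OF that(1)] UR[OF ph(1)[OF that(1)]] UR[OF that(2)] ph(2)[OF that(1)]] that(3) c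
    by (simp add: mult_le_0_iff)
  have min: "f x (ph x) \<le> f x z" if "x \<in> U" "z \<in> U" for x z
  proof -
    have "f x (ph x) + c / 2 * (norm (z - ph x))\<^sup>2 \<le> f x z"
      using lb[of x "ph x" z] that UR ph by simp
    moreover have "0 \<le> c / 2 * (norm (z - ph x))\<^sup>2" using c by simp
    ultimately show ?thesis by linarith
  qed
  have local_min: "local_minimizer (f x) (ph x)" if "x \<in> U" for x
    unfolding local_minimizer_def eventually_nhds using U(1) ph(1) min that by blast
  have local_min_iff: "y \<in> U \<and> local_minimizer (f x) y \<longleftrightarrow> y = ph x" if x: "x \<in> U" for x y
  proof
    assume y: "y \<in> U \<and> local_minimizer (f x) y"
    then obtain S where "open S" "y \<in> S" "\<forall>z\<in>S. f x y \<le> f x z"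
      unfolding local_minimizer_def eventually_nhds by blast
    then have "G x y = 0" using critical by blast
    with x y show "y = ph x" using uniq by blast
  qed (use ph local_min x in blast)
  have arg_min: "\<exists>!y. is_arg_min (f x) (\<lambda>y. y \<in> U) y" if x: "x \<in> U" for x
  proof (rule ex1I)
    show "is_arg_min (f x) (\<lambda>y. y \<in> U) (ph x)" using ph min x by (auto simp: is_arg_min_linorder)
    fix y assume "is_arg_min (f x) (\<lambda>y. y \<in> U) y"
    then have y: "y \<in> U" "\<And>z. z \<in> U \<Longrightarrow> f x y \<le> f x z" by (auto simp: is_arg_min_linorder)
    then show "y = ph x" using uniq[OF x y(1)] critical[OF U(1)] by blast
  qed
  have map_eq: "imf_map V v \<alpha> \<beta> U x = ph x" if "x \<in> U" for x
    unfolding imf_map_def f_def[symmetric] using local_min_iff[OF that]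
    by (simp add: f_def)
  have strict: "strictly_convex_on U (f x)" if "x \<in> U" for x
    using U(2) c lb UR that by (intro strictly_convex_onI_lower_bound[of _ "c / 2" _ "G x"]) auto
  have diag: "G x x = 0 \<longleftrightarrow> gradient V x = 0" for x
    unfolding G_def using imf_gradient_diagonal_eq_0_iff[OF nv] ab by simp
  have grad0: "gradient V xs = 0" using saddle by (simp add: index1_saddle_def)
  then have phs: "ph xs = xs" using uniq[OF U(3) U(3)] diag by simp
  have fixed: "{x \<in> U. imf_map V v \<alpha> \<beta> U x = x} = {xs}" if "\<forall>x\<in>U. gradient V x = 0 \<longrightarrow> x = xs"
    using that map_eq phs ph(2) diag U(3) by force
  have ph_diff: "ph differentiable at x0" if x0: "x0 \<in> U" for x0
  proof -
    obtain w where w: "w differentiable at x0" "\<forall>\<^sub>F z in nhds x0. outer_square (w z) = outer_square (v z)"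
      using local[OF UR[OF x0]] by blast
    \<comment> \<open>This is \<open>G\<close> with \<open>v\<close> replaced by the choice
      \<open>w\<close> that is differentiable at \<open>x0\<close>. The two agree for
      \<open>x\<close> near \<open>x0\<close>.\<close>
    define J where "J = (\<lambda>(y, x). imf_gradient V (w x) \<alpha> \<beta> x y)"
    have J: "J differentiable at (y, x0)" for y
      unfolding J_def by (rule imf_gradient_jointly_differentiable[OF V w(1)])
    then obtain D where D: "(J has_derivative D) (at (ph x0, x0))" by (auto simp: differentiable_def)
    have evU: "\<forall>\<^sub>F x in nhds x0. x \<in> U" using U(1) x0 by (rule eventually_nhds_in_open)
    have JG: "\<forall>\<^sub>F x in nhds x0. J (y, x) = G x y" for y
      using w(2)
    proof eventually_elim
      case (elim x)
      show ?case using imf_gradient_cong[OF elim, of V \<alpha> \<beta>] by (simp add: J_def G_def)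
    qed
    show ?thesis
    proof (rule implicit_differentiable[where y = ph, OF D])
      fix k assume k: "D (k, 0) = 0"
      \<comment> \<open>The partial derivative of \<open>J\<close> in \<open>y\<close> is the
        Hessian of the objective, which coercivity makes injective.\<close>
      have "((\<lambda>y. J (y, x0)) has_derivative (\<lambda>k. D (k, 0))) (at (ph x0))"
        using has_derivative_compose[OF has_derivative_Pair[OF has_derivative_ident has_derivative_const] D]
        by simp
      moreover have "((\<lambda>y. J (y, x0)) has_derivative imf_hessian V (w x0) \<alpha> \<beta> x0 (ph x0)) (at (ph x0))"
        unfolding J_def using imf_gradient_has_derivative[OF V] by simp
      ultimately have "(\<lambda>k. D (k, 0)) = imf_hessian V (w x0) \<alpha> \<beta> x0 (ph x0)"
        by (rule has_derivative_unique)
      moreover have "imf_hessian V (w x0) \<alpha> \<beta> = imf_hessian V (v x0) \<alpha> \<beta>"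
        by (rule imf_hessian_cong[OF eventually_nhds_x_imp_x[OF w(2)]])
      ultimately have "imf_hessian V (v x0) \<alpha> \<beta> x0 (ph x0) k = 0" using k by metis
      then show "k = 0"
        using coercive[OF UR[OF x0] UR[OF ph(1)[OF x0]], of k] c by (simp add: mult_le_0_iff)
    next
      \<comment> \<open>Continuity of \<open>ph\<close>: by \<open>mono\<close>,
        \<open>norm (ph x - ph x0)\<close> is at most \<open>norm (G x (ph x0)) / c\<close>, and the
        gradient at the fixed point \<open>ph x0\<close> tends to \<open>0\<close> as
        \<open>x\<close> tends to \<open>x0\<close>.\<close>
      have "isCont (Pair (ph x0)) x0" by (intro continuous_intros)
      from isCont_o2[where f = "Pair (ph x0)", OF this differentiable_imp_continuous_within[OF J]]
      have "isCont (\<lambda>x. J (ph x0, x)) x0" .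
      from isCont_tendsto_nhds[OF this]
      have "((\<lambda>x. J (ph x0, x)) \<longlongrightarrow> 0) (nhds x0)"
        using eventually_nhds_x_imp_x[OF JG, of "ph x0"] ph(2)[OF x0] by simp
      then have "((\<lambda>x. norm (J (ph x0, x)) / c) \<longlongrightarrow> 0) (nhds x0)"
        using c by (auto intro!: tendsto_eq_intros)
      moreover have "\<forall>\<^sub>F x in nhds x0. norm (ph x - ph x0) \<le> norm (J (ph x0, x)) / c"
        using evU JG[of "ph x0"]
      proof eventually_elim
        case (elim x)
        have "c * norm (ph x0 - ph x) \<le> norm (G x (ph x0))"
          using elim x0 UR ph by (intro mono) auto
        then show ?case using elim c by (simp add: field_simps norm_minus_commute)
      qed
      ultimately have "((\<lambda>x. ph x - ph x0) \<longlongrightarrow> 0) (nhds x0)"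
        by (rule Lim_null_comparison[rotated])
      then show "isCont ph x0"
        unfolding isCont_def tendsto_at_iff_tendsto_nhds by (simp add: LIM_zero_iff)
    next
      show "\<forall>\<^sub>F x in nhds x0. J (ph x, x) = 0"
        using evU w(2)
      proof eventually_elim
        case (elim x)
        then show ?case
          using ph(2)[of x] imf_gradient_cong[OF elim(2), of V \<alpha> \<beta>] by (simp add: J_def G_def)
      qed
    qed
  qed
  \<comment> \<open>The two maps have been identified only on \<open>U\<close>; since
    \<open>U\<close> is open, derivatives at its points carry over.\<close>
  have map_nhds: "\<forall>\<^sub>F x in at x0. ph x = imf_map V v \<alpha> \<beta> U x" if "x0 \<in> U" for x0
    using eventually_at_in_open'[OF U(1) that] by eventually_elim (simp add: map_eq)
  have map_diff: "imf_map V v \<alpha> \<beta> U differentiable_on U"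
  proof -
    have "imf_map V v \<alpha> \<beta> U differentiable at x0" if x0: "x0 \<in> U" for x0
    proof -
      obtain D where "(ph has_derivative D) (at x0)" using ph_diff[OF x0] by (auto simp: differentiable_def)
      then have "(imf_map V v \<alpha> \<beta> U has_derivative D) (at x0)"
        by (rule has_derivative_transform_eventually[OF _ map_nhds[OF x0]]) (simp_all add: map_eq x0)
      then show ?thesis by (auto simp: differentiable_def)
    qed
    then show ?thesis by (simp add: differentiable_on_eq_differentiable_at[OF U(1)])
  qed
  have "(ph has_derivative (\<lambda>_. 0)) (at xs)"
  \<comment> \<open>Since \<open>ph xs = xs\<close>, \<open>mono\<close> with \<open>y2 = xs\<close>
    bounds the increment of \<open>ph\<close> by \<open>norm (G x xs) / c\<close>, which is
    \<open>o(x - xs)\<close>.\<close>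
  proof (rule has_derivative_zero_dominated[OF G_der])
    show "G xs xs = 0" using diag grad0 by simp
    have "\<forall>\<^sub>F x in nhds xs. x \<in> U" using U(1,3) by (rule eventually_nhds_in_open)
    then show "\<forall>\<^sub>F x in nhds xs. norm (ph x - ph xs) \<le> 1 / c * norm (G x xs)"
    proof eventually_elim
      case (elim x)
      have "c * norm (xs - ph x) \<le> norm (G x xs)"
        by (rule mono[OF UR[OF elim] UR[OF ph(1)[OF elim]] UR[OF U(3)] ph(2)[OF elim]])
      then show ?case using c by (simp add: phs field_simps norm_minus_commute)
    qed
  qed (use c in simp)
  then have "(imf_map V v \<alpha> \<beta> U has_derivative (\<lambda>_. 0)) (at xs)"
    by (rule has_derivative_transform_eventually[OF _ map_nhds[OF U(3)]]) (simp_all add: map_eq U(3))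
  then have jac: "jacobian (imf_map V v \<alpha> \<beta> U) (at xs) = 0"
    by (simp add: jacobian_def frechet_derivative_at[symmetric] matrix_def vec_eq_iff)
  have ex1: "\<exists>!y. y \<in> U \<and> local_minimizer (f x) y" if "x \<in> U" for x
    using local_min_iff[OF that] by simp
  have local_min_xs: "local_minimizer (f xs) xs" using local_min[OF U(3)] phs by simp
  show ?thesis
  proof (intro conjI exI[of _ U] ballI impI)
    show "local_minimizer (imf_objective V (v xs) \<alpha> \<beta> xs) xs"
      using local_min_xs unfolding f_def .
    show "open U" "convex U" "xs \<in> U" by (rule U)+
    show "imf_map V v \<alpha> \<beta> U differentiable_on U" by (rule map_diff)
    show "jacobian (imf_map V v \<alpha> \<beta> U) (at xs) = 0" by (rule jac)
  next
    fix x assume x: "x \<in> U"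
    show "strictly_convex_on U (imf_objective V (v x) \<alpha> \<beta> x)"
      using strict[OF x] unfolding f_def .
    show "\<exists>!y. is_arg_min (imf_objective V (v x) \<alpha> \<beta> x) (\<lambda>y. y \<in> U) y"
      using arg_min[OF x] unfolding f_def .
    show "\<exists>!y. y \<in> U \<and> local_minimizer (imf_objective V (v x) \<alpha> \<beta> x) y"
      using ex1[OF x] unfolding f_def .
  next
    assume "\<forall>x\<in>U. gradient V x = 0 \<longrightarrow> x = xs"
    then show "{x \<in> U. imf_map V v \<alpha> \<beta> U x = x} = {xs}" by (rule fixed)
  qed
qed

end
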